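(* Let $(\mathcal C,\otimes,I)$ be a symmetric monoidal category which admits all set-indexed coproducts of its unit object $I$, these coproducts being preserved by the tensor product in each variable. Then the monoidal coalgebra modality $P$ on $\mathcal C$ induced by the symmetric monoidal adjunction $L\dashv\mathcal C(I,-)$, where $\mathcal C(I,-)\colon(\mathcal C,\otimes,I)\to(\mathsf{SET},\times,1)$ and $L(Z)=\bigoplus_{z\in Z}I$, is the initial monoidal coalgebra modality on $(\mathcal C,\otimes,I)$.
   Context: Associativity and unit constraints are suppressed; $\sigma$ is the symmetry. A coalgebra modality on $\mathcal C$ is a comonad $(!,\varepsilon,\delta)$ with natural maps $\mathsf e_X\colon !X\to I$, $\Delta_X\colon !X\to !X\otimes !X$ making each $!X$ a cocommutative comonoid such that each $\delta_X\colon !X\to !!X$ is a comonoid morphism. A monoidal comonad is a comonad with maps $m_I\colon I\to !I$ and natural $m_{X,Y}\colon !X\otimes !Y\to !(X\otimes Y)$ making $!$ a (lax) symmetric monoidal functor and $\varepsilon,\delta$ monoidal natural transformations. A monoidal coalgebra modality is a comonad with both structures such that: $m_I$ and $m_{X,Y}$ are comonoid homomorphisms (where $I$ is the trivial comonoid and $!X\otimes !Y$ has counit $\mathsf e_X\otimes\mathsf e_Y$ and comultiplication $(1\otimes\sigma\otimes1)\circ(\Delta_X\otimes\Delta_Y)$), and $\mathsf e_X\colon(!X,\delta_X)\to(I,m_I)$ and $\Delta_X\colon(!X,\delta_X)\to(!X\otimes !X,\,m_{!X,!X}\circ(\delta_X\otimes\delta_X))$ are morphisms of $!$-coalgebras.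 A morphism of monoidal coalgebra modalities is a monoidal natural transformation $\varphi\colon !^1\to !^2$ with $\varepsilon^2\varphi=\varepsilon^1$, $\delta^2\varphi=(\varphi\varphi)\delta^1$, whose components are comonoid homomorphisms. "Initial" means initial object in the resulting category. Explicitly, $PX=\bigoplus_{x\colon I\to X}I$, with coproduct injections $\iota_x\colon I\to PX$ for each map $x\colon I\to X$. The structure of $P$ is determined by the following, for all maps $x\colon I\to X$, $y\colon I\to Y$, $f\colon X\to Y$: $Pf\circ\iota_x=\iota_{f\circ x}$; $\mathsf e^P_X\circ\iota_x=1_I$; $\Delta^P_X\circ\iota_x=\iota_x\otimes\iota_x$; $\varepsilon^P_X\circ\iota_x=x$; $\delta^P_X\circ\iota_x=\iota_{\iota_x}$; $m^P_I=\iota_{1_I}$; $m^P_{X,Y}\circ(\iota_x\otimes\iota_y)=\iota_{x\otimes y}$. *)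

theory Defs
  imports Main "HOL-Library.FuncSet"
begin

unbundle cardinal_syntax

section \<open>Categories, functors, natural transformations\<close>

record ('o, 'a) category =
  Ob :: "'o set"
  Ar :: "'a set"
  Dom :: "'a \<Rightarrow> 'o"
  Cod :: "'a \<Rightarrow> 'o"
  Idn :: "'o \<Rightarrow> 'a"
  Cmp :: "'a \<Rightarrow> 'a \<Rightarrow> 'a" (infixr "\<cdot>\<index>" 60)

definition hom :: "('o, 'a, 'm) category_scheme \<Rightarrow> 'o \<Rightarrow> 'o \<Rightarrow> 'a set" where
  "hom C x y = {f \<in> Ar C. Dom C f = x \<and> Cod C f = y}"

locale category =
  fixes C :: "('o, 'a, 'm) category_scheme" (structure)
  assumes Dom_Ob: "f \<in> Ar C \<Longrightarrow> Dom C f \<in> Ob C"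
    and Cod_Ob: "f \<in> Ar C \<Longrightarrow> Cod C f \<in> Ob C"
    and Id_hom: "x \<in> Ob C \<Longrightarrow> Idn C x \<in> hom C x x"
    and Cmp_hom: "f \<in> hom C x y \<Longrightarrow> g \<in> hom C y z \<Longrightarrow> g \<cdot> f \<in> hom C x z"
    and Id_left: "f \<in> hom C x y \<Longrightarrow> Idn C y \<cdot> f = f"
    and Id_right: "f \<in> hom C x y \<Longrightarrow> f \<cdot> Idn C x = f"
    and Cmp_assoc: "f \<in> hom C w x \<Longrightarrow> g \<in> hom C x y \<Longrightarrow> h \<in> hom C y z
      \<Longrightarrow> (h \<cdot> g) \<cdot> f = h \<cdot> (g \<cdot> f)"

definition inverse_arrows :: "('o, 'a, 'm) category_scheme \<Rightarrow> 'a \<Rightarrow> 'a \<Rightarrow> bool" where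
  "inverse_arrows C f g \<longleftrightarrow> f \<in> Ar C \<and> g \<in> hom C (Cod C f) (Dom C f) \<and>
     g \<cdot>\<^bsub>C\<^esub> f = Idn C (Dom C f) \<and> f \<cdot>\<^bsub>C\<^esub> g = Idn C (Cod C f)"

definition is_iso :: "('o, 'a, 'm) category_scheme \<Rightarrow> 'a \<Rightarrow> bool" where
  "is_iso C f \<longleftrightarrow> (\<exists>g. inverse_arrows C f g)"

definition inv_ar :: "('o, 'a, 'm) category_scheme \<Rightarrow> 'a \<Rightarrow> 'a" where
  "inv_ar C f = (THE g. inverse_arrows C f g)"

definition initial_object :: "('o, 'a, 'm) category_scheme \<Rightarrow> 'o \<Rightarrow> bool" where
  "initial_object C x \<longleftrightarrow> x \<in> Ob C \<and> (\<forall>y \<in> Ob C. \<exists>!f. f \<in> hom C x y)"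

text \<open>The object \<open>c\<close> with injections \<open>\<iota> z\<close> is a coproduct of the family \<open>F z\<close>, \<open>z \<in> Z\<close>.\<close>

definition is_coproduct ::
  "('o, 'a, 'm) category_scheme \<Rightarrow> 'z set \<Rightarrow> ('z \<Rightarrow> 'o) \<Rightarrow> 'o \<Rightarrow> ('z \<Rightarrow> 'a) \<Rightarrow> bool" where
  "is_coproduct C Z F c \<iota> \<longleftrightarrow> c \<in> Ob C \<and> (\<forall>z \<in> Z. \<iota> z \<in> hom C (F z) c) \<and>
     (\<forall>y \<in> Ob C. \<forall>g. (\<forall>z \<in> Z. g z \<in> hom C (F z) y) \<longrightarrow>
        (\<exists>!h. h \<in> hom C c y \<and> (\<forall>z \<in> Z. h \<cdot>\<^bsub>C\<^esub> \<iota> z = g z)))"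

record ('o, 'a, 'p, 'b) cfunctor =
  FO :: "'o \<Rightarrow> 'p"
  FA :: "'a \<Rightarrow> 'b"

locale cat_functor = C?: category C + D?: category D
  for C :: "('o, 'a, 'm) category_scheme" and D :: "('p, 'b, 'n) category_scheme" +
  fixes F :: "('o, 'a, 'p, 'b, 'f) cfunctor_scheme"
  assumes FO_Ob: "x \<in> Ob C \<Longrightarrow> FO F x \<in> Ob D"
    and FA_hom: "f \<in> hom C x y \<Longrightarrow> FA F f \<in> hom D (FO F x) (FO F y)"
    and FA_Id: "x \<in> Ob C \<Longrightarrow> FA F (Idn C x) = Idn D (FO F x)"
    and FA_Cmp: "f \<in> hom C x y \<Longrightarrow> g \<in> hom C y z
      \<Longrightarrow> FA F (g \<cdot>\<^bsub>C\<^esub> f) = FA F g \<cdot>\<^bsub>D\<^esub> FA F f"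

locale nat_trans = F?: cat_functor C D F + G?: cat_functor C D G
  for C :: "('o, 'a, 'm) category_scheme" and D :: "('p, 'b, 'n) category_scheme"
    and F :: "('o, 'a, 'p, 'b, 'f) cfunctor_scheme"
    and G :: "('o, 'a, 'p, 'b, 'g) cfunctor_scheme" +
  fixes \<tau> :: "'o \<Rightarrow> 'b"
  assumes component_hom: "x \<in> Ob C \<Longrightarrow> \<tau> x \<in> hom D (FO F x) (FO G x)"
    and naturality: "f \<in> hom C x y \<Longrightarrow> \<tau> y \<cdot>\<^bsub>D\<^esub> FA F f = FA G f \<cdot>\<^bsub>D\<^esub> \<tau> x"


section \<open>Symmetric monoidal categories\<close>

record ('o, 'a) smcat = "('o, 'a) category" +
  Unit :: "'o" ("\<one>\<index>")
  TO :: "'o \<Rightarrow> 'o \<Rightarrow> 'o" (infixr "\<otimes>\<index>" 70)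
  TA :: "'a \<Rightarrow> 'a \<Rightarrow> 'a" (infixr "\<boxtimes>\<index>" 70)
  Asc :: "'o \<Rightarrow> 'o \<Rightarrow> 'o \<Rightarrow> 'a"
  Lun :: "'o \<Rightarrow> 'a"
  Run :: "'o \<Rightarrow> 'a"
  Sym :: "'o \<Rightarrow> 'o \<Rightarrow> 'a"

locale symmetric_monoidal_category = category C
  for C :: "('o, 'a, 'm) smcat_scheme" (structure) +
  assumes Unit_Ob: "\<one> \<in> Ob C"
    and TO_Ob: "x \<in> Ob C \<Longrightarrow> y \<in> Ob C \<Longrightarrow> x \<otimes> y \<in> Ob C"
    and TA_hom: "f \<in> hom C x y \<Longrightarrow> g \<in> hom C z w \<Longrightarrow> f \<boxtimes> g \<in> hom C (x \<otimes> z) (y \<otimes> w)"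
    and TA_Id: "x \<in> Ob C \<Longrightarrow> y \<in> Ob C \<Longrightarrow> Idn C x \<boxtimes> Idn C y = Idn C (x \<otimes> y)"
    and TA_Cmp: "f \<in> hom C x y \<Longrightarrow> f' \<in> hom C y z \<Longrightarrow> g \<in> hom C u v \<Longrightarrow> g' \<in> hom C v w
      \<Longrightarrow> (f' \<cdot> f) \<boxtimes> (g' \<cdot> g) = (f' \<boxtimes> g') \<cdot> (f \<boxtimes> g)"
    and Asc_hom: "x \<in> Ob C \<Longrightarrow> y \<in> Ob C \<Longrightarrow> z \<in> Ob C
      \<Longrightarrow> Asc C x y z \<in> hom C ((x \<otimes> y) \<otimes> z) (x \<otimes> (y \<otimes> z))"
    and Asc_iso: "x \<in> Ob C \<Longrightarrow> y \<in> Ob C \<Longrightarrow> z \<in> Ob C \<Longrightarrow> is_iso C (Asc C x y z)"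
    and Asc_natural: "f \<in> hom C x x' \<Longrightarrow> g \<in> hom C y y' \<Longrightarrow> h \<in> hom C z z'
      \<Longrightarrow> Asc C x' y' z' \<cdot> ((f \<boxtimes> g) \<boxtimes> h) = (f \<boxtimes> (g \<boxtimes> h)) \<cdot> Asc C x y z"
    and Lun_hom: "x \<in> Ob C \<Longrightarrow> Lun C x \<in> hom C (\<one> \<otimes> x) x"
    and Lun_iso: "x \<in> Ob C \<Longrightarrow> is_iso C (Lun C x)"
    and Lun_natural: "f \<in> hom C x y \<Longrightarrow> Lun C y \<cdot> (Idn C \<one> \<boxtimes> f) = f \<cdot> Lun C x"
    and Run_hom: "x \<in> Ob C \<Longrightarrow> Run C x \<in> hom C (x \<otimes> \<one>) x"
    and Run_iso: "x \<in> Ob C \<Longrightarrow> is_iso C (Run C x)"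
    and Run_natural: "f \<in> hom C x y \<Longrightarrow> Run C y \<cdot> (f \<boxtimes> Idn C \<one>) = f \<cdot> Run C x"
    and Sym_hom: "x \<in> Ob C \<Longrightarrow> y \<in> Ob C \<Longrightarrow> Sym C x y \<in> hom C (x \<otimes> y) (y \<otimes> x)"
    and Sym_natural: "f \<in> hom C x x' \<Longrightarrow> g \<in> hom C y y'
      \<Longrightarrow> Sym C x' y' \<cdot> (f \<boxtimes> g) = (g \<boxtimes> f) \<cdot> Sym C x y"
    and pentagon: "w \<in> Ob C \<Longrightarrow> x \<in> Ob C \<Longrightarrow> y \<in> Ob C \<Longrightarrow> z \<in> Ob C
      \<Longrightarrow> Asc C w x (y \<otimes> z) \<cdot> Asc C (w \<otimes> x) y z =
        (Idn C w \<boxtimes> Asc C x y z) \<cdot> Asc C w (x \<otimes> y) z \<cdot> (Asc C w x y \<boxtimes> Idn C z)"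
    and triangle: "x \<in> Ob C \<Longrightarrow> y \<in> Ob C
      \<Longrightarrow> (Idn C x \<boxtimes> Lun C y) \<cdot> Asc C x \<one> y = Run C x \<boxtimes> Idn C y"
    and hexagon: "x \<in> Ob C \<Longrightarrow> y \<in> Ob C \<Longrightarrow> z \<in> Ob C
      \<Longrightarrow> Asc C y z x \<cdot> Sym C x (y \<otimes> z) \<cdot> Asc C x y z =
        (Idn C y \<boxtimes> Sym C x z) \<cdot> Asc C y x z \<cdot> (Sym C x y \<boxtimes> Idn C z)"
    and Sym_Sym: "x \<in> Ob C \<Longrightarrow> y \<in> Ob C \<Longrightarrow> Sym C y x \<cdot> Sym C x y = Idn C (x \<otimes> y)"

record ('o, 'a, 'p, 'b) mfunctor = "('o, 'a, 'p, 'b) cfunctor" +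
  M0 :: "'b"
  M2 :: "'o \<Rightarrow> 'o \<Rightarrow> 'b"

locale lax_symmetric_monoidal_functor =
  C?: symmetric_monoidal_category C + D?: symmetric_monoidal_category D + cat_functor C D F
  for C :: "('o, 'a, 'm) smcat_scheme" and D :: "('p, 'b, 'n) smcat_scheme"
    and F :: "('o, 'a, 'p, 'b, 'f) mfunctor_scheme" +
  assumes M0_hom: "M0 F \<in> hom D \<one>\<^bsub>D\<^esub> (FO F \<one>\<^bsub>C\<^esub>)"
    and M2_hom: "x \<in> Ob C \<Longrightarrow> y \<in> Ob C
      \<Longrightarrow> M2 F x y \<in> hom D (FO F x \<otimes>\<^bsub>D\<^esub> FO F y) (FO F (x \<otimes>\<^bsub>C\<^esub> y))"
    and M2_natural: "f \<in> hom C x x' \<Longrightarrow> g \<in> hom C y y'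
      \<Longrightarrow> M2 F x' y' \<cdot>\<^bsub>D\<^esub> (FA F f \<boxtimes>\<^bsub>D\<^esub> FA F g) = FA F (f \<boxtimes>\<^bsub>C\<^esub> g) \<cdot>\<^bsub>D\<^esub> M2 F x y"
    and M2_Asc: "x \<in> Ob C \<Longrightarrow> y \<in> Ob C \<Longrightarrow> z \<in> Ob C
      \<Longrightarrow> FA F (Asc C x y z) \<cdot>\<^bsub>D\<^esub> M2 F (x \<otimes>\<^bsub>C\<^esub> y) z \<cdot>\<^bsub>D\<^esub> (M2 F x y \<boxtimes>\<^bsub>D\<^esub> Idn D (FO F z)) =
        M2 F x (y \<otimes>\<^bsub>C\<^esub> z) \<cdot>\<^bsub>D\<^esub> (Idn D (FO F x) \<boxtimes>\<^bsub>D\<^esub> M2 F y z) \<cdot>\<^bsub>D\<^esub> Asc D (FO F x) (FO F y) (FO F z)"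
    and M2_Lun: "x \<in> Ob C
      \<Longrightarrow> FA F (Lun C x) \<cdot>\<^bsub>D\<^esub> M2 F \<one>\<^bsub>C\<^esub> x \<cdot>\<^bsub>D\<^esub> (M0 F \<boxtimes>\<^bsub>D\<^esub> Idn D (FO F x)) = Lun D (FO F x)"
    and M2_Run: "x \<in> Ob C
      \<Longrightarrow> FA F (Run C x) \<cdot>\<^bsub>D\<^esub> M2 F x \<one>\<^bsub>C\<^esub> \<cdot>\<^bsub>D\<^esub> (Idn D (FO F x) \<boxtimes>\<^bsub>D\<^esub> M0 F) = Run D (FO F x)"
    and M2_Sym: "x \<in> Ob C \<Longrightarrow> y \<in> Ob C
      \<Longrightarrow> FA F (Sym C x y) \<cdot>\<^bsub>D\<^esub> M2 F x y = M2 F y x \<cdot>\<^bsub>D\<^esub> Sym D (FO F x) (FO F y)"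

locale monoidal_nat_trans = nat_trans C D F G \<tau> +
  F?: lax_symmetric_monoidal_functor C D F + G?: lax_symmetric_monoidal_functor C D G
  for C :: "('o, 'a, 'm) smcat_scheme" and D :: "('p, 'b, 'n) smcat_scheme"
    and F :: "('o, 'a, 'p, 'b, 'f) mfunctor_scheme"
    and G :: "('o, 'a, 'p, 'b, 'g) mfunctor_scheme"
    and \<tau> :: "'o \<Rightarrow> 'b" +
  assumes monoidal_M0: "\<tau> \<one>\<^bsub>C\<^esub> \<cdot>\<^bsub>D\<^esub> M0 F = M0 G"
    and monoidal_M2: "x \<in> Ob C \<Longrightarrow> y \<in> Ob C
      \<Longrightarrow> \<tau> (x \<otimes>\<^bsub>C\<^esub> y) \<cdot>\<^bsub>D\<^esub> M2 F x y = M2 G x y \<cdot>\<^bsub>D\<^esub> (\<tau> x \<boxtimes>\<^bsub>D\<^esub> \<tau> y)"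

definition id_mfunctor :: "('o, 'a, 'm) smcat_scheme \<Rightarrow> ('o, 'a, 'o, 'a) mfunctor" where
  "id_mfunctor C = \<lparr>FO = (\<lambda>x. x), FA = (\<lambda>f. f), M0 = Idn C \<one>\<^bsub>C\<^esub>, M2 = (\<lambda>x y. Idn C (x \<otimes>\<^bsub>C\<^esub> y))\<rparr>"

text \<open>\<open>comp_mfunctor E G F\<close> is the composite \<open>G \<circ> F\<close>, where \<open>E\<close> is the codomain of \<open>G\<close>.\<close>

definition comp_mfunctor ::
  "('q, 'c, 'm) smcat_scheme \<Rightarrow> ('p, 'b, 'q, 'c, 'g) mfunctor_scheme \<Rightarrow> ('o, 'a, 'p, 'b, 'f) mfunctor_scheme
    \<Rightarrow> ('o, 'a, 'q, 'c) mfunctor" where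
  "comp_mfunctor E G F = \<lparr>
     FO = (\<lambda>x. FO G (FO F x)),
     FA = (\<lambda>f. FA G (FA F f)),
     M0 = FA G (M0 F) \<cdot>\<^bsub>E\<^esub> M0 G,
     M2 = (\<lambda>x y. FA G (M2 F x y) \<cdot>\<^bsub>E\<^esub> M2 G (FO F x) (FO F y))\<rparr>"

locale symmetric_monoidal_adjunction =
  L?: lax_symmetric_monoidal_functor D C L +
  R?: lax_symmetric_monoidal_functor C D R +
  unit?: monoidal_nat_trans D D "id_mfunctor D" "comp_mfunctor D R L" \<eta> +
  counit?: monoidal_nat_trans C C "comp_mfunctor C L R" "id_mfunctor C" \<epsilon>
  for D :: "('p, 'b, 'n) smcat_scheme" and C :: "('o, 'a, 'm) smcat_scheme"
    and L :: "('p, 'b, 'o, 'a, 'f) mfunctor_scheme" and R :: "('o, 'a, 'p, 'b, 'g) mfunctor_scheme"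
    and \<eta> :: "'p \<Rightarrow> 'b" and \<epsilon> :: "'o \<Rightarrow> 'a" +
  assumes triangle_L: "z \<in> Ob D \<Longrightarrow> \<epsilon> (FO L z) \<cdot>\<^bsub>C\<^esub> FA L (\<eta> z) = Idn C (FO L z)"
    and triangle_R: "x \<in> Ob C \<Longrightarrow> FA R (\<epsilon> x) \<cdot>\<^bsub>D\<^esub> \<eta> (FO R x) = Idn D (FO R x)"


section \<open>Comonoids\<close>

locale cocommutative_comonoid = symmetric_monoidal_category C
  for C :: "('o, 'a, 'm) smcat_scheme" (structure) and A :: 'o and e d :: 'a +
  assumes carrier_Ob: "A \<in> Ob C"
    and counit_hom: "e \<in> hom C A \<one>"
    and comult_hom: "d \<in> hom C A (A \<otimes> A)"
    and coassoc: "Asc C A A A \<cdot> (d \<boxtimes> Idn C A) \<cdot> d = (Idn C A \<boxtimes> d) \<cdot> d"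
    and counit_left: "Lun C A \<cdot> (e \<boxtimes> Idn C A) \<cdot> d = Idn C A"
    and counit_right: "Run C A \<cdot> (Idn C A \<boxtimes> e) \<cdot> d = Idn C A"
    and cocommutative: "Sym C A A \<cdot> d = d"

text \<open>A comonoid is passed as a triple of carrier, counit and comultiplication.\<close>

fun comonoid_hom :: "('o, 'a, 'm) smcat_scheme \<Rightarrow> 'o \<times> 'a \<times> 'a \<Rightarrow> 'o \<times> 'a \<times> 'a \<Rightarrow> 'a \<Rightarrow> bool" where
  "comonoid_hom C (A, e, d) (A', e', d') f \<longleftrightarrow>
     f \<in> hom C A A' \<and> e' \<cdot>\<^bsub>C\<^esub> f = e \<and> d' \<cdot>\<^bsub>C\<^esub> f = (f \<boxtimes>\<^bsub>C\<^esub> f) \<cdot>\<^bsub>C\<^esub> d"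

definition unit_comonoid :: "('o, 'a, 'm) smcat_scheme \<Rightarrow> 'o \<times> 'a \<times> 'a" where
  "unit_comonoid C = (\<one>\<^bsub>C\<^esub>, Idn C \<one>\<^bsub>C\<^esub>, inv_ar C (Lun C \<one>\<^bsub>C\<^esub>))"

text \<open>The map \<open>1 \<otimes> \<sigma> \<otimes> 1 : (w \<otimes> x) \<otimes> (y \<otimes> z) \<rightarrow> (w \<otimes> y) \<otimes> (x \<otimes> z)\<close>.\<close>

definition middle_swap :: "('o, 'a, 'm) smcat_scheme \<Rightarrow> 'o \<Rightarrow> 'o \<Rightarrow> 'o \<Rightarrow> 'o \<Rightarrow> 'a" where
  "middle_swap C w x y z =
     inv_ar C (Asc C w y (x \<otimes>\<^bsub>C\<^esub> z)) \<cdot>\<^bsub>C\<^esub>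
     (Idn C w \<boxtimes>\<^bsub>C\<^esub> (Asc C y x z \<cdot>\<^bsub>C\<^esub> (Sym C x y \<boxtimes>\<^bsub>C\<^esub> Idn C z) \<cdot>\<^bsub>C\<^esub> inv_ar C (Asc C x y z))) \<cdot>\<^bsub>C\<^esub>
     Asc C w x (y \<otimes>\<^bsub>C\<^esub> z)"

fun tensor_comonoid ::
  "('o, 'a, 'm) smcat_scheme \<Rightarrow> 'o \<times> 'a \<times> 'a \<Rightarrow> 'o \<times> 'a \<times> 'a \<Rightarrow> 'o \<times> 'a \<times> 'a" where
  "tensor_comonoid C (A, e, d) (A', e', d') =
     (A \<otimes>\<^bsub>C\<^esub> A', Lun C \<one>\<^bsub>C\<^esub> \<cdot>\<^bsub>C\<^esub> (e \<boxtimes>\<^bsub>C\<^esub> e'), middle_swap C A A A' A' \<cdot>\<^bsub>C\<^esub> (d \<boxtimes>\<^bsub>C\<^esub> d'))"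


section \<open>Monoidal coalgebra modalities\<close>

text \<open>
  A modality \<open>!\<close> consists of a monoidal functor with structure maps \<open>M0\<close>, \<open>M2\<close>, of \<open>\<epsilon> = Der\<close> and \<open>\<delta> = Dig\<close>
  (dereliction and digging), and of \<open>e = Disc\<close> and \<open>\<Delta> = Dup\<close> (discarding and duplication).
\<close>

record ('o, 'a) modality = "('o, 'a, 'o, 'a) mfunctor" +
  Der :: "'o \<Rightarrow> 'a"
  Dig :: "'o \<Rightarrow> 'a"
  Disc :: "'o \<Rightarrow> 'a"
  Dup :: "'o \<Rightarrow> 'a"

definition comonoid_of :: "('o, 'a, 'f) modality_scheme \<Rightarrow> 'o \<Rightarrow> 'o \<times> 'a \<times> 'a" where
  "comonoid_of M x = (FO M x, Disc M x, Dup M x)"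

locale comonad =
  Der?: nat_trans C C M "id_mfunctor C" "Der M" +
  Dig?: nat_trans C C M "comp_mfunctor C M M" "Dig M"
  for C :: "('o, 'a, 'm) smcat_scheme" (structure) and M :: "('o, 'a, 'f) modality_scheme" +
  assumes Der_Dig: "x \<in> Ob C \<Longrightarrow> Der M (FO M x) \<cdot> Dig M x = Idn C (FO M x)"
    and FA_Der_Dig: "x \<in> Ob C \<Longrightarrow> FA M (Der M x) \<cdot> Dig M x = Idn C (FO M x)"
    and Dig_Dig: "x \<in> Ob C \<Longrightarrow> Dig M (FO M x) \<cdot> Dig M x = FA M (Dig M x) \<cdot> Dig M x"

locale coalgebra_modality = comonad C M + symmetric_monoidal_category C
  for C :: "('o, 'a, 'm) smcat_scheme" (structure) and M :: "('o, 'a, 'f) modality_scheme" +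
  assumes comonoid: "x \<in> Ob C \<Longrightarrow> cocommutative_comonoid C (FO M x) (Disc M x) (Dup M x)"
    and Disc_natural: "f \<in> hom C x y \<Longrightarrow> Disc M y \<cdot> FA M f = Disc M x"
    and Dup_natural: "f \<in> hom C x y \<Longrightarrow> Dup M y \<cdot> FA M f = (FA M f \<boxtimes> FA M f) \<cdot> Dup M x"
    and Dig_comonoid_hom: "x \<in> Ob C
      \<Longrightarrow> comonoid_hom C (comonoid_of M x) (comonoid_of M (FO M x)) (Dig M x)"

locale monoidal_comonad = comonad C M +
  Der?: monoidal_nat_trans C C M "id_mfunctor C" "Der M" +
  Dig?: monoidal_nat_trans C C M "comp_mfunctor C M M" "Dig M"
  for C :: "('o, 'a, 'm) smcat_scheme" (structure) and M :: "('o, 'a, 'f) modality_scheme"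

text \<open>Morphisms of coalgebras for the comonad \<open>M\<close>, a coalgebra being a pair of carrier and coaction.\<close>

fun coalgebra_hom ::
  "('o, 'a, 'm) smcat_scheme \<Rightarrow> ('o, 'a, 'f) modality_scheme \<Rightarrow> 'o \<times> 'a \<Rightarrow> 'o \<times> 'a \<Rightarrow> 'a \<Rightarrow> bool" where
  "coalgebra_hom C M (A, a) (B, b) f \<longleftrightarrow> f \<in> hom C A B \<and> b \<cdot>\<^bsub>C\<^esub> f = FA M f \<cdot>\<^bsub>C\<^esub> a"

locale monoidal_coalgebra_modality = coalgebra_modality C M + monoidal_comonad C M
  for C :: "('o, 'a, 'm) smcat_scheme" (structure) and M :: "('o, 'a, 'f) modality_scheme" +
  assumes M0_comonoid_hom: "comonoid_hom C (unit_comonoid C) (comonoid_of M \<one>) (M0 M)"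
    and M2_comonoid_hom: "x \<in> Ob C \<Longrightarrow> y \<in> Ob C
      \<Longrightarrow> comonoid_hom C (tensor_comonoid C (comonoid_of M x) (comonoid_of M y))
            (comonoid_of M (x \<otimes> y)) (M2 M x y)"
    and Disc_coalgebra_hom: "x \<in> Ob C
      \<Longrightarrow> coalgebra_hom C M (FO M x, Dig M x) (\<one>, M0 M) (Disc M x)"
    and Dup_coalgebra_hom: "x \<in> Ob C
      \<Longrightarrow> coalgebra_hom C M (FO M x, Dig M x)
            (FO M x \<otimes> FO M x, M2 M (FO M x) (FO M x) \<cdot> (Dig M x \<boxtimes> Dig M x)) (Dup M x)"

locale modality_morphism =
  M?: monoidal_coalgebra_modality C M + N?: monoidal_coalgebra_modality C N +
  monoidal_nat_trans C C M N \<phi>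
  for C :: "('o, 'a, 'm) smcat_scheme" (structure)
    and M :: "('o, 'a, 'f) modality_scheme" and N :: "('o, 'a, 'g) modality_scheme"
    and \<phi> :: "'o \<Rightarrow> 'a" +
  assumes Der_morphism: "x \<in> Ob C \<Longrightarrow> Der N x \<cdot> \<phi> x = Der M x"
    and Dig_morphism: "x \<in> Ob C \<Longrightarrow> Dig N x \<cdot> \<phi> x = (\<phi> (FO N x) \<cdot> FA M (\<phi> x)) \<cdot> Dig M x"
    and component_comonoid_hom: "x \<in> Ob C
      \<Longrightarrow> comonoid_hom C (comonoid_of M x) (comonoid_of N x) (\<phi> x)"

text \<open>
  The category of monoidal coalgebra modalities on \<open>C\<close>.  An arrow records its domain and codomain;
  its family of components is \<open>undefined\<close> off the objects of \<open>C\<close>, so that two arrows are equal as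
  soon as their components agree on the objects of \<open>C\<close>.
\<close>

definition modality_category ::
  "('o, 'a, 'm) smcat_scheme
    \<Rightarrow> (('o, 'a) modality, ('o, 'a) modality \<times> ('o \<Rightarrow> 'a) \<times> ('o, 'a) modality) category" where
  "modality_category C = \<lparr>
     Ob = {M. monoidal_coalgebra_modality C M},
     Ar = {(M, \<phi>, N). modality_morphism C M N \<phi> \<and> \<phi> \<in> extensional (Ob C)},
     Dom = (\<lambda>(M, \<phi>, N). M),
     Cod = (\<lambda>(M, \<phi>, N). N),
     Idn = (\<lambda>M. (M, \<lambda>x \<in> Ob C. Idn C (FO M x), M)),
     Cmp = (\<lambda>(M', \<psi>, N) (M, \<phi>, N'). (M, \<lambda>x \<in> Ob C. \<psi> x \<cdot>\<^bsub>C\<^esub> \<phi> x, N))\<rparr>"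


section \<open>The cartesian category of small sets\<close>

text \<open>
  Small sets are the sets of cardinality less than a cardinal \<open>\<kappa>\<close> (thought of as the size of the
  set-theoretic universe).  A bound is needed: coproducts of the unit object indexed by arbitrary
  sets of arrows exist only if each hom-set out of the unit object has at most one element.  To
  have one HOL type of elements, small sets are realised as sets of formal tuples built from
  elements of the field of \<open>\<kappa>\<close>, which provide every small set up to bijection, and from arrows of
  the given category, which provide its hom-sets.
\<close>

datatype ('k, 'a) elt =
    Star
  | Base 'k
  | Arrow (the_Arrow: 'a)
  | Pr (pr1: "('k, 'a) elt") (pr2: "('k, 'a) elt")

type_synonym ('k, 'a) elts = "('k, 'a) elt set"
type_synonym ('k, 'a) sfun = "('k, 'a) elts \<times> (('k, 'a) elt \<Rightarrow> ('k, 'a) elt) \<times> ('k, 'a) elts"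

definition sfun ::
  "('k, 'a) elts \<Rightarrow> (('k, 'a) elt \<Rightarrow> ('k, 'a) elt) \<Rightarrow> ('k, 'a) elts \<Rightarrow> ('k, 'a) sfun" where
  "sfun A f B = (A, restrict f A, B)"

definition sprod :: "('k, 'a) elts \<Rightarrow> ('k, 'a) elts \<Rightarrow> ('k, 'a) elts" where
  "sprod A B = {Pr a b | a b. a \<in> A \<and> b \<in> B}"

definition SET :: "'k rel \<Rightarrow> (('k, 'a) elts, ('k, 'a) sfun) smcat" where
  "SET \<kappa> = \<lparr>
     Ob = {A. |A| <o \<kappa>},
     Ar = {(A, f, B). |A| <o \<kappa> \<and> |B| <o \<kappa> \<and> f \<in> A \<rightarrow>\<^sub>E B},
     Dom = (\<lambda>(A, f, B). A),
     Cod = (\<lambda>(A, f, B). B),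
     Idn = (\<lambda>A. sfun A (\<lambda>a. a) A),
     Cmp = (\<lambda>(B', g, D) (A, f, B). sfun A (\<lambda>a. g (f a)) D),
     Unit = {Star},
     TO = sprod,
     TA = (\<lambda>(A, f, B) (A', f', B').
             sfun (sprod A A') (\<lambda>p. Pr (f (pr1 p)) (f' (pr2 p))) (sprod B B')),
     Asc = (\<lambda>A B D. sfun (sprod (sprod A B) D)
              (\<lambda>p. Pr (pr1 (pr1 p)) (Pr (pr2 (pr1 p)) (pr2 p))) (sprod A (sprod B D))),
     Lun = (\<lambda>A. sfun (sprod {Star} A) pr2 A),
     Run = (\<lambda>A. sfun (sprod A {Star}) pr1 A),
     Sym = (\<lambda>A B. sfun (sprod A B) (\<lambda>p. Pr (pr2 p) (pr1 p)) (sprod B A))\<rparr>"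

definition terminal_map :: "('k, 'a) elts \<Rightarrow> ('k, 'a) sfun" where
  "terminal_map A = sfun A (\<lambda>a. Star) {Star}"

definition diagonal :: "('k, 'a) elts \<Rightarrow> ('k, 'a) sfun" where
  "diagonal A = sfun A (\<lambda>a. Pr a a) (sprod A A)"


section \<open>The adjunction between small sets and a symmetric monoidal category\<close>

definition points :: "('o, 'a, 'm) smcat_scheme \<Rightarrow> 'o \<Rightarrow> ('k, 'a) elts" where
  "points C x = Arrow ` hom C \<one>\<^bsub>C\<^esub> x"

definition points_functor ::
  "('o, 'a, 'm) smcat_scheme \<Rightarrow> ('o, 'a, ('k, 'a) elts, ('k, 'a) sfun) mfunctor" where
  "points_functor C = \<lparr>
     FO = points C,
     FA = (\<lambda>f. sfun (points C (Dom C f)) (\<lambda>p. Arrow (f \<cdot>\<^bsub>C\<^esub> the_Arrow p)) (points C (Cod C f))),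
     M0 = sfun {Star} (\<lambda>p. Arrow (Idn C \<one>\<^bsub>C\<^esub>)) (points C \<one>\<^bsub>C\<^esub>),
     M2 = (\<lambda>x y. sfun (sprod (points C x) (points C y))
             (\<lambda>p. Arrow ((the_Arrow (pr1 p) \<boxtimes>\<^bsub>C\<^esub> the_Arrow (pr2 p)) \<cdot>\<^bsub>C\<^esub> inv_ar C (Lun C \<one>\<^bsub>C\<^esub>)))
             (points C (x \<otimes>\<^bsub>C\<^esub> y)))\<rparr>"

text \<open>
  In what follows \<open>cop Z\<close> is a chosen coproduct of \<open>Z\<close> copies of the unit object, with injections
  \<open>\<iota> Z z\<close>.  The structure map of \<open>copower_functor\<close> at \<open>Z\<close>, \<open>W\<close> is the canonical map
  \<open>cop Z \<otimes> cop W \<rightarrow> cop (Z \<times> W)\<close>; it is well defined when the tensor product preserves these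
  coproducts in each variable.
\<close>

definition copower_functor ::
  "('o, 'a, 'm) smcat_scheme \<Rightarrow> (('k, 'a) elts \<Rightarrow> 'o) \<Rightarrow> (('k, 'a) elts \<Rightarrow> ('k, 'a) elt \<Rightarrow> 'a)
    \<Rightarrow> (('k, 'a) elts, ('k, 'a) sfun, 'o, 'a) mfunctor" where
  "copower_functor C cop \<iota> = \<lparr>
     FO = cop,
     FA = (\<lambda>(Z, f, W). THE h. h \<in> hom C (cop Z) (cop W) \<and> (\<forall>z \<in> Z. h \<cdot>\<^bsub>C\<^esub> \<iota> Z z = \<iota> W (f z))),
     M0 = \<iota> {Star} Star,
     M2 = (\<lambda>Z W. THE h. h \<in> hom C (cop Z \<otimes>\<^bsub>C\<^esub> cop W) (cop (sprod Z W)) \<and>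
             (\<forall>z \<in> Z. \<forall>w \<in> W. h \<cdot>\<^bsub>C\<^esub> (\<iota> Z z \<boxtimes>\<^bsub>C\<^esub> \<iota> W w) = \<iota> (sprod Z W) (Pr z w) \<cdot>\<^bsub>C\<^esub> Lun C \<one>\<^bsub>C\<^esub>))\<rparr>"

definition copower_unit ::
  "('o, 'a, 'm) smcat_scheme \<Rightarrow> (('k, 'a) elts \<Rightarrow> 'o) \<Rightarrow> (('k, 'a) elts \<Rightarrow> ('k, 'a) elt \<Rightarrow> 'a)
    \<Rightarrow> ('k, 'a) elts \<Rightarrow> ('k, 'a) sfun" where
  "copower_unit C cop \<iota> Z = sfun Z (\<lambda>z. Arrow (\<iota> Z z)) (points C (cop Z))"

definition copower_counit ::
  "('o, 'a, 'm) smcat_scheme \<Rightarrow> (('k, 'a) elts \<Rightarrow> 'o) \<Rightarrow> (('k, 'a) elts \<Rightarrow> ('k, 'a) elt \<Rightarrow> 'a)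
    \<Rightarrow> 'o \<Rightarrow> 'a" where
  "copower_counit C cop \<iota> x =
     (THE h. h \<in> hom C (cop (points C x)) x \<and> (\<forall>p \<in> points C x. h \<cdot>\<^bsub>C\<^esub> \<iota> (points C x) p = the_Arrow p))"

text \<open>
  The modality \<open>L \<circ> R\<close> on \<open>C\<close> induced by a symmetric monoidal adjunction (\<open>L\<close> left adjoint to \<open>R\<close>) with
  the cartesian category of small sets: the composite monoidal comonad, together with the comonoid structure
  obtained by transporting the terminal maps and diagonals of sets along the strong monoidal
  functor \<open>L\<close>.
\<close>

definition induced_modality ::
  "('o, 'a, 'm) smcat_scheme
    \<Rightarrow> (('k, 'a) elts, ('k, 'a) sfun, 'o, 'a, 'f) mfunctor_scheme
    \<Rightarrow> ('o, 'a, ('k, 'a) elts, ('k, 'a) sfun, 'g) mfunctor_scheme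
    \<Rightarrow> (('k, 'a) elts \<Rightarrow> ('k, 'a) sfun) \<Rightarrow> ('o \<Rightarrow> 'a) \<Rightarrow> ('o, 'a) modality" where
  "induced_modality C L R \<eta> \<epsilon> = \<lparr>
     FO = FO (comp_mfunctor C L R),
     FA = FA (comp_mfunctor C L R),
     M0 = M0 (comp_mfunctor C L R),
     M2 = M2 (comp_mfunctor C L R),
     Der = \<epsilon>,
     Dig = (\<lambda>x. FA L (\<eta> (FO R x))),
     Disc = (\<lambda>x. inv_ar C (M0 L) \<cdot>\<^bsub>C\<^esub> FA L (terminal_map (FO R x))),
     Dup = (\<lambda>x. inv_ar C (M2 L (FO R x) (FO R x)) \<cdot>\<^bsub>C\<^esub> FA L (diagonal (FO R x)))\<rparr>"

text \<open>
  \<open>C\<close> admits all coproducts of its unit object indexed by small sets, \<open>cop\<close> and \<open>\<iota>\<close> being a choice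
  of such coproducts, and these coproducts are preserved by the tensor product in each variable.
\<close>

definition unit_copowers ::
  "('o, 'a, 'm) smcat_scheme \<Rightarrow> 'k rel \<Rightarrow> (('k, 'a) elts \<Rightarrow> 'o)
    \<Rightarrow> (('k, 'a) elts \<Rightarrow> ('k, 'a) elt \<Rightarrow> 'a) \<Rightarrow> bool" where
  "unit_copowers C \<kappa> cop \<iota> \<longleftrightarrow> (\<forall>Z. |Z| <o \<kappa> \<longrightarrow> is_coproduct C Z (\<lambda>z. \<one>\<^bsub>C\<^esub>) (cop Z) (\<iota> Z))"

definition tensor_preserves_unit_copowers ::
  "('o, 'a, 'm) smcat_scheme \<Rightarrow> 'k rel \<Rightarrow> (('k, 'a) elts \<Rightarrow> 'o)
    \<Rightarrow> (('k, 'a) elts \<Rightarrow> ('k, 'a) elt \<Rightarrow> 'a) \<Rightarrow> bool" where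
  "tensor_preserves_unit_copowers C \<kappa> cop \<iota> \<longleftrightarrow> (\<forall>Z. |Z| <o \<kappa> \<longrightarrow> (\<forall>x \<in> Ob C.
     is_coproduct C Z (\<lambda>z. x \<otimes>\<^bsub>C\<^esub> \<one>\<^bsub>C\<^esub>) (x \<otimes>\<^bsub>C\<^esub> cop Z) (\<lambda>z. Idn C x \<boxtimes>\<^bsub>C\<^esub> \<iota> Z z) \<and>
     is_coproduct C Z (\<lambda>z. \<one>\<^bsub>C\<^esub> \<otimes>\<^bsub>C\<^esub> x) (cop Z \<otimes>\<^bsub>C\<^esub> x) (\<lambda>z. \<iota> Z z \<boxtimes>\<^bsub>C\<^esub> Idn C x)))"

end

theory Submission
  imports Defs
begin

text \<open>
  The copower of the unit object indexed by a set \<open>Z\<close> is generated by its injections: a map out of it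
  is determined by, and can be prescribed freely on, the points \<open>\<iota> Z z\<close>.  As the tensor product
  preserves these copowers, maps out of a tensor product of copowers are likewise determined by
  their values on the points \<open>\<iota> Z z \<star> \<iota> W w\<close>, where \<open>p \<star> q\<close> is the tensor product of two points,
  seen again as a point through the isomorphism of the unit with its tensor square
  (\<open>generating_cop_TO\<close>).  So every equation required of the adjunction and of the induced modality
  \<open>P\<close> can be checked on points, where the structure of \<open>P\<close> is the evident one: for instance
  \<open>P f\<close> sends the point \<open>\<iota>\<^sub>p\<close> to \<open>\<iota>\<close> at \<open>f \<cdot> p\<close>, and duplication sends \<open>\<iota>\<^sub>p\<close> to \<open>\<iota>\<^sub>p \<star> \<iota>\<^sub>p\<close>.

  What makes points easy to compute with is coherence.  The associator, the unitors and the
  symmetry act on points \<open>p \<star> q\<close> as the corresponding bijections act on pairs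
  (\<open>Asc_point_tensor\<close>, \<open>Lun_point_tensor\<close>, \<open>Run_point_tensor\<close>, \<open>Sym_point_tensor\<close>).  This rests on two
  facts about the unit object: its two unitors agree (\<open>Lun_Unit_eq_Run_Unit\<close>) and its symmetry with
  itself is the identity (\<open>Sym_Unit_Unit\<close>).

  For initiality, let \<open>N\<close> be any monoidal coalgebra modality.  Since \<open>\<iota>\<^sub>p\<close> is \<open>P p\<close> composed with the unit map
  of \<open>P\<close>, naturality and preservation of the unit map force a morphism from \<open>P\<close> to \<open>N\<close> to send \<open>\<iota>\<^sub>p\<close> to
  the point \<open>lift p\<close>, which is \<open>N p\<close> composed with the unit map of \<open>N\<close> (\<open>modality_morphism_unique\<close>).
  Conversely these values define a map on every \<open>P x\<close>.  Because the unit map of \<open>N\<close> makes the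
  unit object a coalgebra and is a comonoid homomorphism, \<open>lift\<close> commutes with all the operations of a modality
  (\<open>Der_lift\<close>, \<open>Dig_lift\<close>, \<open>M2_lift\<close>, \<open>Disc_lift\<close>, \<open>Dup_lift\<close>), which is what the axioms of a
  morphism say on points.
\<close>

section \<open>Composition by typing rules\<close>

text \<open>
  Arrows are handled through their domain and codomain instead of through membership in hom-sets:
  the side conditions of the category axioms then mention no variables beyond the arrows involved,
  and rewriting can discharge them.
\<close>

lemma hom_iff: "f \<in> hom C x y \<longleftrightarrow> f \<in> Ar C \<and> Dom C f = x \<and> Cod C f = y"
  by (simp add: hom_def)

context category
begin

declare Dom_Ob [simp] Cod_Ob [simp]

lemma Idn_typing [simp]:
  assumes "x \<in> Ob C"
  shows "Idn C x \<in> Ar C" "Dom C (Idn C x) = x" "Cod C (Idn C x) = x"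
  using Id_hom [OF assms] by (simp_all add: hom_iff)

lemma Cmp_typing [simp]:
  assumes "f \<in> Ar C" "g \<in> Ar C" "Cod C f = Dom C g"
  shows "g \<cdot> f \<in> Ar C" "Dom C (g \<cdot> f) = Dom C f" "Cod C (g \<cdot> f) = Cod C g"
  using Cmp_hom [of f "Dom C f" "Cod C f" g "Cod C g"] assms by (simp_all add: hom_iff)

lemma Cmp_Idn [simp]:
  assumes "f \<in> Ar C"
  shows "Cod C f = y \<Longrightarrow> Idn C y \<cdot> f = f" "Dom C f = x \<Longrightarrow> f \<cdot> Idn C x = f"
  using Id_left [of f "Dom C f" "Cod C f"] Id_right [of f "Dom C f" "Cod C f"] assms
  by (simp_all add: hom_iff)

lemma Cmp_Cmp [simp]:
  assumes "f \<in> Ar C" "g \<in> Ar C" "h \<in> Ar C" "Cod C f = Dom C g" "Cod C g = Dom C h"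
  shows "(h \<cdot> g) \<cdot> f = h \<cdot> (g \<cdot> f)"
  using Cmp_assoc [of f _ _ g _ h] assms by (simp add: hom_iff)

lemma inverse_arrows_unique:
  assumes "inverse_arrows C f g" "inverse_arrows C f h"
  shows "g = h"
proof -
  have "g = g \<cdot> (f \<cdot> h)"
    using assms by (auto simp: inverse_arrows_def hom_iff)
  also have "\<dots> = (g \<cdot> f) \<cdot> h"
    using assms by (subst Cmp_Cmp) (auto simp: inverse_arrows_def hom_iff)
  also have "\<dots> = h"
    using assms by (auto simp: inverse_arrows_def hom_iff)
  finally show ?thesis .
qed

lemma inv_ar_eqI: "inverse_arrows C f g \<Longrightarrow> inv_ar C f = g"
  unfolding inv_ar_def by (blast intro: the_equality inverse_arrows_unique)

lemma inverse_arrows_inv_ar: "is_iso C f \<Longrightarrow> inverse_arrows C f (inv_ar C f)"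
  unfolding is_iso_def using inv_ar_eqI by auto

lemma inv_ar_typing [simp]:
  assumes "is_iso C f"
  shows "f \<in> Ar C" "inv_ar C f \<in> Ar C" "Dom C (inv_ar C f) = Cod C f"
    "Cod C (inv_ar C f) = Dom C f"
  using inverse_arrows_inv_ar [OF assms] by (auto simp: inverse_arrows_def hom_iff)

lemma inv_ar_cancel [simp]:
  assumes "is_iso C f"
  shows "f \<cdot> inv_ar C f = Idn C (Cod C f)" "inv_ar C f \<cdot> f = Idn C (Dom C f)"
    "h \<in> Ar C \<Longrightarrow> Cod C h = Cod C f \<Longrightarrow> f \<cdot> (inv_ar C f \<cdot> h) = h"
    "h \<in> Ar C \<Longrightarrow> Cod C h = Dom C f \<Longrightarrow> inv_ar C f \<cdot> (f \<cdot> h) = h"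
proof -
  show *: "f \<cdot> inv_ar C f = Idn C (Cod C f)" "inv_ar C f \<cdot> f = Idn C (Dom C f)"
    using inverse_arrows_inv_ar [OF assms] by (auto simp: inverse_arrows_def hom_iff)
  show "f \<cdot> (inv_ar C f \<cdot> h) = h" if "h \<in> Ar C" "Cod C h = Cod C f"
    using that assms * Cmp_Cmp [of h "inv_ar C f" f] by simp
  show "inv_ar C f \<cdot> (f \<cdot> h) = h" if "h \<in> Ar C" "Cod C h = Dom C f"
    using that assms * Cmp_Cmp [of h f "inv_ar C f"] by simp
qed

lemma iso_cancel_left:
  assumes "is_iso C f" "f \<cdot> g = f \<cdot> h" "g \<in> Ar C" "h \<in> Ar C" "Cod C g = Dom C f" "Cod C h = Dom C f"
  shows "g = h"
  using assms inv_ar_cancel(4) by metis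

lemma iso_cancel_right:
  assumes "is_iso C f" "g \<cdot> f = h \<cdot> f" "g \<in> Ar C" "h \<in> Ar C" "Dom C g = Cod C f" "Dom C h = Cod C f"
  shows "g = h"
proof -
  have "(g \<cdot> f) \<cdot> inv_ar C f = (h \<cdot> f) \<cdot> inv_ar C f"
    using assms by simp
  then show ?thesis using assms(1,3-) by simp
qed

lemma inv_ar_Cmp_eq_iff:
  assumes "is_iso C f" "g \<in> Ar C" "h \<in> Ar C" "Cod C g = Cod C f" "Cod C h = Dom C f"
  shows "inv_ar C f \<cdot> g = h \<longleftrightarrow> g = f \<cdot> h"
  using assms by auto

end

section \<open>Coherence at the unit object\<close>

context symmetric_monoidal_category
begin

declare Unit_Ob [simp] TO_Ob [simp] TA_Id [simp] Asc_iso [simp] Lun_iso [simp] Run_iso [simp]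

lemma TA_typing [simp]:
  assumes "f \<in> Ar C" "g \<in> Ar C"
  shows "f \<boxtimes> g \<in> Ar C" "Dom C (f \<boxtimes> g) = Dom C f \<otimes> Dom C g" "Cod C (f \<boxtimes> g) = Cod C f \<otimes> Cod C g"
  using TA_hom [of f _ _ g] assms by (auto simp: hom_iff)

lemma Asc_typing [simp]:
  assumes "x \<in> Ob C" "y \<in> Ob C" "z \<in> Ob C"
  shows "Asc C x y z \<in> Ar C" "Dom C (Asc C x y z) = (x \<otimes> y) \<otimes> z" "Cod C (Asc C x y z) = x \<otimes> (y \<otimes> z)"
  using Asc_hom assms by (simp_all add: hom_iff)

lemma Lun_typing [simp]:
  assumes "x \<in> Ob C"
  shows "Lun C x \<in> Ar C" "Dom C (Lun C x) = \<one> \<otimes> x" "Cod C (Lun C x) = x"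
  using Lun_hom assms by (simp_all add: hom_iff)

lemma Run_typing [simp]:
  assumes "x \<in> Ob C"
  shows "Run C x \<in> Ar C" "Dom C (Run C x) = x \<otimes> \<one>" "Cod C (Run C x) = x"
  using Run_hom assms by (simp_all add: hom_iff)

lemma Sym_typing [simp]:
  assumes "x \<in> Ob C" "y \<in> Ob C"
  shows "Sym C x y \<in> Ar C" "Dom C (Sym C x y) = x \<otimes> y" "Cod C (Sym C x y) = y \<otimes> x"
  using Sym_hom assms by (simp_all add: hom_iff)

lemma TA_TA [simp]:
  assumes "f \<in> Ar C" "f' \<in> Ar C" "g \<in> Ar C" "g' \<in> Ar C" "Cod C f = Dom C f'" "Cod C g = Dom C g'"
  shows "(f' \<boxtimes> g') \<cdot> (f \<boxtimes> g) = (f' \<cdot> f) \<boxtimes> (g' \<cdot> g)"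
  using TA_Cmp [of f _ _ f' _ g _ _ g'] assms by (simp add: hom_iff)

lemma TA_TA_Cmp [simp]:
  assumes "f \<in> Ar C" "f' \<in> Ar C" "g \<in> Ar C" "g' \<in> Ar C" "Cod C f = Dom C f'" "Cod C g = Dom C g'"
    "h \<in> Ar C" "Cod C h = Dom C f \<otimes> Dom C g"
  shows "(f' \<boxtimes> g') \<cdot> ((f \<boxtimes> g) \<cdot> h) = ((f' \<cdot> f) \<boxtimes> (g' \<cdot> g)) \<cdot> h"
  using Cmp_Cmp [of h "f \<boxtimes> g" "f' \<boxtimes> g'"] assms by simp

lemma is_iso_TA:
  assumes "is_iso C f" "is_iso C g"
  shows "is_iso C (f \<boxtimes> g)"
  unfolding is_iso_def inverse_arrows_def
  by (rule exI [of _ "inv_ar C f \<boxtimes> inv_ar C g"]) (simp add: assms hom_iff)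

lemma is_iso_Idn [simp]: "x \<in> Ob C \<Longrightarrow> is_iso C (Idn C x)"
  unfolding is_iso_def inverse_arrows_def by (rule exI [of _ "Idn C x"]) (simp add: hom_iff)

lemma Lun_nat: "f \<in> Ar C \<Longrightarrow> Lun C (Cod C f) \<cdot> (Idn C \<one> \<boxtimes> f) = f \<cdot> Lun C (Dom C f)"
  by (rule Lun_natural) (simp add: hom_iff)

lemma Run_nat: "f \<in> Ar C \<Longrightarrow> Run C (Cod C f) \<cdot> (f \<boxtimes> Idn C \<one>) = f \<cdot> Run C (Dom C f)"
  by (rule Run_natural) (simp add: hom_iff)

lemma Asc_nat: "f \<in> Ar C \<Longrightarrow> g \<in> Ar C \<Longrightarrow> h \<in> Ar C \<Longrightarrow>
   Asc C (Cod C f) (Cod C g) (Cod C h) \<cdot> ((f \<boxtimes> g) \<boxtimes> h)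
     = (f \<boxtimes> (g \<boxtimes> h)) \<cdot> Asc C (Dom C f) (Dom C g) (Dom C h)"
  by (rule Asc_natural) (simp_all add: hom_iff)

lemma Sym_nat: "f \<in> Ar C \<Longrightarrow> g \<in> Ar C \<Longrightarrow>
   Sym C (Cod C f) (Cod C g) \<cdot> (f \<boxtimes> g) = (g \<boxtimes> f) \<cdot> Sym C (Dom C f) (Dom C g)"
  by (rule Sym_natural) (simp_all add: hom_iff)

text \<open>Naturality of the unitors makes tensoring with the unit object faithful.\<close>

lemma Unit_TA_faithful:
  assumes "Idn C \<one> \<boxtimes> f = Idn C \<one> \<boxtimes> g" "f \<in> Ar C" "g \<in> Ar C" "Dom C f = Dom C g" "Cod C f = Cod C g"
  shows "f = g"
proof (rule iso_cancel_right [of "Lun C (Dom C f)"])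
  show "f \<cdot> Lun C (Dom C f) = g \<cdot> Lun C (Dom C f)"
    using Lun_nat [of f] Lun_nat [of g] assms by simp
qed (use assms in simp_all)

lemma TA_Unit_faithful:
  assumes "f \<boxtimes> Idn C \<one> = g \<boxtimes> Idn C \<one>" "f \<in> Ar C" "g \<in> Ar C" "Dom C f = Dom C g" "Cod C f = Cod C g"
  shows "f = g"
proof (rule iso_cancel_right [of "Run C (Dom C f)"])
  show "f \<cdot> Run C (Dom C f) = g \<cdot> Run C (Dom C f)"
    using Run_nat [of f] Run_nat [of g] assms by simp
qed (use assms in simp_all)

text \<open>
  The first step of Kelly's argument that the two unitors of the unit object agree.  After
  tensoring with the unit object, this is what the pentagon says once the triangle has been used
  twice.
\<close>

lemma Lun_TO_Asc:
  assumes x: "x \<in> Ob C" and y: "y \<in> Ob C"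
  shows "Lun C (x \<otimes> y) \<cdot> Asc C \<one> x y = Lun C x \<boxtimes> Idn C y"
proof (rule Unit_TA_faithful)
  let ?a = "Asc C \<one> x y" and ?l = "Lun C (x \<otimes> y)"
  let ?k = "Asc C \<one> (\<one> \<otimes> x) y \<cdot> (Asc C \<one> \<one> x \<boxtimes> Idn C y)"
  have "(Idn C \<one> \<boxtimes> (?l \<cdot> ?a)) \<cdot> ?k = (Idn C \<one> \<boxtimes> ?l) \<cdot> ((Idn C \<one> \<boxtimes> ?a) \<cdot> ?k)"
    using x y by simp
  also have "\<dots> = (Idn C \<one> \<boxtimes> ?l) \<cdot> (Asc C \<one> \<one> (x \<otimes> y) \<cdot> Asc C (\<one> \<otimes> \<one>) x y)"
    using pentagon [of \<one> \<one> x y] x y by simp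
  also have "\<dots> = ((Idn C \<one> \<boxtimes> ?l) \<cdot> Asc C \<one> \<one> (x \<otimes> y)) \<cdot> Asc C (\<one> \<otimes> \<one>) x y"
    using x y by simp
  also have "\<dots> = (Run C \<one> \<boxtimes> Idn C (x \<otimes> y)) \<cdot> Asc C (\<one> \<otimes> \<one>) x y"
    using x y by (simp only: triangle TO_Ob Unit_Ob)
  also have "\<dots> = ?a \<cdot> ((Run C \<one> \<boxtimes> Idn C x) \<boxtimes> Idn C y)"
    using Asc_nat [of "Run C \<one>" "Idn C x" "Idn C y"] x y by simp
  also have "\<dots> = ?a \<cdot> (((Idn C \<one> \<boxtimes> Lun C x) \<cdot> Asc C \<one> \<one> x) \<boxtimes> Idn C y)"
    using triangle [of \<one> x] x y by simp
  also have "\<dots> = ?a \<cdot> ((Idn C \<one> \<boxtimes> Lun C x) \<boxtimes> Idn C y) \<cdot> (Asc C \<one> \<one> x \<boxtimes> Idn C y)"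
    using x y by simp
  also have "\<dots> = (?a \<cdot> ((Idn C \<one> \<boxtimes> Lun C x) \<boxtimes> Idn C y)) \<cdot> (Asc C \<one> \<one> x \<boxtimes> Idn C y)"
    using x y Cmp_Cmp by simp
  also have "\<dots> = (Idn C \<one> \<boxtimes> (Lun C x \<boxtimes> Idn C y)) \<cdot> ?k"
    using Asc_nat [of "Idn C \<one>" "Lun C x" "Idn C y"] x y by simp
  finally have *: "(Idn C \<one> \<boxtimes> (?l \<cdot> ?a)) \<cdot> ?k = (Idn C \<one> \<boxtimes> (Lun C x \<boxtimes> Idn C y)) \<cdot> ?k" .
  \<comment> \<open>Both factors of \<open>?k\<close> are isomorphisms, so they cancel.\<close>
  have iso: "is_iso C (Asc C \<one> \<one> x \<boxtimes> Idn C y)"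
    using x y by (intro is_iso_TA) simp_all
  have **: "(Idn C \<one> \<boxtimes> (?l \<cdot> ?a)) \<cdot> Asc C \<one> (\<one> \<otimes> x) y
      = (Idn C \<one> \<boxtimes> (Lun C x \<boxtimes> Idn C y)) \<cdot> Asc C \<one> (\<one> \<otimes> x) y"
    by (rule iso_cancel_right [OF iso]) (use * x y in simp_all)
  show "Idn C \<one> \<boxtimes> (?l \<cdot> ?a) = Idn C \<one> \<boxtimes> (Lun C x \<boxtimes> Idn C y)"
    by (rule iso_cancel_right [OF _ **]) (use x y in simp_all)
qed (use x y in simp_all)

text \<open>
  Naturality of the left unitor at the left unitor itself, which is then cancelled.
\<close>

lemma Lun_Unit_TO: "x \<in> Ob C \<Longrightarrow> Lun C (\<one> \<otimes> x) = Idn C \<one> \<boxtimes> Lun C x"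
  by (rule iso_cancel_left [of "Lun C x"]) (use Lun_nat [of "Lun C x"] in simp_all)

lemma Lun_Unit_eq_Run_Unit: "Run C \<one> = Lun C \<one>"
proof (rule TA_Unit_faithful)
  show "Run C \<one> \<boxtimes> Idn C \<one> = Lun C \<one> \<boxtimes> Idn C \<one>"
    using triangle [of \<one> \<one>] Lun_TO_Asc [of \<one> \<one>] Lun_Unit_TO [of \<one>] by simp
qed simp_all

text \<open>
  The symmetry of the unit object with itself is conjugate, along the unitor, to an endomorphism \<open>t\<close> of
  the unit.  The hexagon becomes \<open>t = t \<cdot> t\<close>, and \<open>t\<close> is an involution.
\<close>

lemma Sym_Unit_Unit: "Sym C \<one> \<one> = Idn C (\<one> \<otimes> \<one>)"
proof -
  let ?i = "Idn C \<one>"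
  define s where "s = Sym C \<one> \<one>"
  define l where "l = Lun C \<one>"
  define l' where "l' = inv_ar C l"
  define a where "a = Asc C \<one> \<one> \<one>"
  define t where "t = l \<cdot> s \<cdot> l'"
  have [simp]: "s \<in> Ar C" "Dom C s = \<one> \<otimes> \<one>" "Cod C s = \<one> \<otimes> \<one>"
    "l \<in> Ar C" "Dom C l = \<one> \<otimes> \<one>" "Cod C l = \<one>"
    "l' \<in> Ar C" "Cod C l' = \<one> \<otimes> \<one>" "Dom C l' = \<one>"
    "l \<cdot> l' = ?i" "l' \<cdot> l = Idn C (\<one> \<otimes> \<one>)"
    "a \<in> Ar C" "Dom C a = (\<one> \<otimes> \<one>) \<otimes> \<one>" "Cod C a = \<one> \<otimes> (\<one> \<otimes> \<one>)"
    "\<And>h. h \<in> Ar C \<Longrightarrow> Cod C h = \<one> \<Longrightarrow> l \<cdot> (l' \<cdot> h) = h"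
    "\<And>h. h \<in> Ar C \<Longrightarrow> Cod C h = \<one> \<otimes> \<one> \<Longrightarrow> l' \<cdot> (l \<cdot> h) = h"
    by (simp_all add: s_def l_def l'_def a_def)
  have t [simp]: "t \<in> Ar C" "Dom C t = \<one>" "Cod C t = \<one>"
    by (simp_all add: t_def)
  have tri: "(?i \<boxtimes> l) \<cdot> a = l \<boxtimes> ?i"
    using triangle [of \<one> \<one>] by (simp add: Lun_Unit_eq_Run_Unit l_def a_def)
  have S: "Sym C \<one> (\<one> \<otimes> \<one>) = (l' \<boxtimes> ?i) \<cdot> s \<cdot> (?i \<boxtimes> l)"
  proof -
    have "s \<cdot> (?i \<boxtimes> l) = (l \<boxtimes> ?i) \<cdot> Sym C \<one> (\<one> \<otimes> \<one>)"
      using Sym_nat [of ?i l] by (simp add: s_def)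
    then show ?thesis by simp
  qed
  have "s \<cdot> (l \<boxtimes> ?i) = s \<cdot> ((?i \<boxtimes> l) \<cdot> a)"
    by (simp add: tri)
  also have "\<dots> = (l \<boxtimes> ?i) \<cdot> ((l' \<boxtimes> ?i) \<cdot> s \<cdot> (?i \<boxtimes> l) \<cdot> a)"
    by simp
  also have "\<dots> = ((?i \<boxtimes> l) \<cdot> a) \<cdot> ((l' \<boxtimes> ?i) \<cdot> s \<cdot> (?i \<boxtimes> l) \<cdot> a)"
    by (simp only: tri)
  also have "\<dots> = (?i \<boxtimes> l) \<cdot> (a \<cdot> Sym C \<one> (\<one> \<otimes> \<one>) \<cdot> a)"
    by (simp add: S)
  also have "a \<cdot> Sym C \<one> (\<one> \<otimes> \<one>) \<cdot> a = (?i \<boxtimes> s) \<cdot> a \<cdot> (s \<boxtimes> ?i)"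
    using hexagon [of \<one> \<one> \<one>] by (simp add: a_def s_def)
  also have "(?i \<boxtimes> l) \<cdot> ((?i \<boxtimes> s) \<cdot> a \<cdot> (s \<boxtimes> ?i)) = (?i \<boxtimes> t) \<cdot> ((?i \<boxtimes> l) \<cdot> a) \<cdot> (s \<boxtimes> ?i)"
    by (simp add: t_def)
  also have "\<dots> = (?i \<boxtimes> t) \<cdot> (t \<boxtimes> ?i) \<cdot> (l \<boxtimes> ?i)"
    by (subst tri) (simp add: t_def)
  finally have "(s \<cdot> (l \<boxtimes> ?i)) \<cdot> (l' \<boxtimes> ?i) = ((?i \<boxtimes> t) \<cdot> (t \<boxtimes> ?i) \<cdot> (l \<boxtimes> ?i)) \<cdot> (l' \<boxtimes> ?i)"
    by simp
  then have s: "s = (?i \<boxtimes> t) \<cdot> (t \<boxtimes> ?i)"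
    by simp
  have "l \<cdot> (?i \<boxtimes> t) = t \<cdot> l" "l \<cdot> (t \<boxtimes> ?i) = t \<cdot> l"
    using Lun_nat [of t] Run_nat [of t] by (simp_all add: l_def Lun_Unit_eq_Run_Unit)
  moreover have "l \<cdot> s = (l \<cdot> (?i \<boxtimes> t)) \<cdot> (t \<boxtimes> ?i)"
    by (subst s) (simp del: TA_TA)
  ultimately have "l \<cdot> s = t \<cdot> t \<cdot> l"
    by simp
  then have "(l \<cdot> s) \<cdot> l' = (t \<cdot> t \<cdot> l) \<cdot> l'"
    by simp
  then have "t = t \<cdot> t"
    by (simp add: t_def [symmetric])
  also have "\<dots> = l \<cdot> (s \<cdot> s) \<cdot> l'"
    by (simp add: t_def)
  also have "s \<cdot> s = Idn C (\<one> \<otimes> \<one>)"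
    by (simp add: s_def Sym_Sym)
  finally have "t = ?i"
    by simp
  with s show ?thesis
    by (simp add: s_def)
qed

end

section \<open>Points and generating families of points\<close>

text \<open>
  The inverse unitor turns the tensor product of two points, a map out of the tensor square of the
  unit, back into a point.  This is the lax structure of the functor of points.
\<close>

definition point_tensor :: "('o, 'a, 'm) smcat_scheme \<Rightarrow> 'a \<Rightarrow> 'a \<Rightarrow> 'a" (infixr "\<star>\<index>" 70) where
  "point_tensor C p q = (p \<boxtimes>\<^bsub>C\<^esub> q) \<cdot>\<^bsub>C\<^esub> inv_ar C (Lun C \<one>\<^bsub>C\<^esub>)"

text \<open>Only points are allowed as generators, so that generators of tensor factors can be tensored.\<close>

definition generating :: "('o, 'a, 'm) smcat_scheme \<Rightarrow> 'o \<Rightarrow> 'a set \<Rightarrow> bool" where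
  "generating C x S \<longleftrightarrow> x \<in> Ob C \<and> S \<subseteq> hom C \<one>\<^bsub>C\<^esub> x \<and>
     (\<forall>y f g. f \<in> hom C x y \<longrightarrow> g \<in> hom C x y \<longrightarrow> (\<forall>p \<in> S. f \<cdot>\<^bsub>C\<^esub> p = g \<cdot>\<^bsub>C\<^esub> p) \<longrightarrow> f = g)"

context symmetric_monoidal_category
begin

lemma point_tensor_typing [simp]:
  assumes "p \<in> Ar C" "q \<in> Ar C" "Dom C p = \<one>" "Dom C q = \<one>"
  shows "p \<star> q \<in> Ar C" "Dom C (p \<star> q) = \<one>" "Cod C (p \<star> q) = Cod C p \<otimes> Cod C q"
  unfolding point_tensor_def using assms by simp_all

lemma TA_point_tensor [simp]:
  assumes "p \<in> Ar C" "q \<in> Ar C" "Dom C p = \<one>" "Dom C q = \<one>"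
    "f \<in> Ar C" "g \<in> Ar C" "Cod C p = Dom C f" "Cod C q = Dom C g"
  shows "(f \<boxtimes> g) \<cdot> (p \<star> q) = (f \<cdot> p) \<star> (g \<cdot> q)"
  unfolding point_tensor_def using assms by simp

lemma Lun_point_tensor [simp]:
  assumes "p \<in> Ar C" "Dom C p = \<one>" "Cod C p = x"
  shows "Lun C x \<cdot> (Idn C \<one> \<star> p) = p"
proof -
  have "Lun C x \<cdot> (Idn C \<one> \<star> p) = (Lun C x \<cdot> (Idn C \<one> \<boxtimes> p)) \<cdot> inv_ar C (Lun C \<one>)"
    unfolding point_tensor_def using assms by auto
  then show ?thesis
    using Lun_nat [of p] assms by simp
qed

lemma Run_point_tensor [simp]:
  assumes "p \<in> Ar C" "Dom C p = \<one>" "Cod C p = x"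
  shows "Run C x \<cdot> (p \<star> Idn C \<one>) = p"
proof -
  have "Run C x \<cdot> (p \<star> Idn C \<one>) = (Run C x \<cdot> (p \<boxtimes> Idn C \<one>)) \<cdot> inv_ar C (Lun C \<one>)"
    unfolding point_tensor_def using assms by auto
  then show ?thesis
    using Run_nat [of p] assms by (simp add: Lun_Unit_eq_Run_Unit)
qed

text \<open>
  Naturality moves the associator to three copies of the unit, where the triangle axiom, with the
  two unitors of the unit identified, determines it.
\<close>

lemma Asc_point_tensor [simp]:
  assumes "p \<in> Ar C" "q \<in> Ar C" "r \<in> Ar C" "Dom C p = \<one>" "Dom C q = \<one>" "Dom C r = \<one>"
    "Cod C p = x" "Cod C q = y" "Cod C r = z"
  shows "Asc C x y z \<cdot> ((p \<star> q) \<star> r) = p \<star> (q \<star> r)"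
proof -
  let ?i = "Idn C \<one>" and ?l = "inv_ar C (Lun C \<one>)"
  have "Asc C x y z \<cdot> ((p \<boxtimes> q) \<boxtimes> r) = (p \<boxtimes> (q \<boxtimes> r)) \<cdot> Asc C \<one> \<one> \<one>"
    using Asc_nat [of p q r] assms by simp
  moreover have "(p \<star> q) \<star> r = ((p \<boxtimes> q) \<boxtimes> r) \<cdot> ((?l \<boxtimes> ?i) \<cdot> ?l)"
    unfolding point_tensor_def using assms by simp
  moreover define k where "k = (?l \<boxtimes> ?i) \<cdot> ?l"
  moreover have [simp]: "k \<in> Ar C" "Dom C k = \<one>" "Cod C k = (\<one> \<otimes> \<one>) \<otimes> \<one>"
    by (simp_all add: k_def)
  ultimately have "Asc C x y z \<cdot> ((p \<star> q) \<star> r) = (p \<boxtimes> (q \<boxtimes> r)) \<cdot> (Asc C \<one> \<one> \<one> \<cdot> k)"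
    using assms Cmp_Cmp [of k "(p \<boxtimes> q) \<boxtimes> r" "Asc C x y z"] by auto
  moreover have "Asc C \<one> \<one> \<one> \<cdot> (?l \<boxtimes> ?i) = ?i \<boxtimes> ?l"
  proof (rule iso_cancel_left [of "?i \<boxtimes> Lun C \<one>"])
    have "((?i \<boxtimes> Lun C \<one>) \<cdot> Asc C \<one> \<one> \<one>) \<cdot> (?l \<boxtimes> ?i) = Idn C (\<one> \<otimes> \<one>)"
      by (simp only: triangle Unit_Ob) (simp add: Lun_Unit_eq_Run_Unit)
    then show "(?i \<boxtimes> Lun C \<one>) \<cdot> Asc C \<one> \<one> \<one> \<cdot> (?l \<boxtimes> ?i) = (?i \<boxtimes> Lun C \<one>) \<cdot> (?i \<boxtimes> ?l)"
      by simp
  qed (simp_all add: is_iso_TA)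
  then have "Asc C \<one> \<one> \<one> \<cdot> k = (?i \<boxtimes> ?l) \<cdot> ?l"
    using Cmp_Cmp [of ?l "?l \<boxtimes> ?i" "Asc C \<one> \<one> \<one>"] by (simp add: k_def)
  ultimately show ?thesis
    unfolding point_tensor_def using assms by simp
qed

lemma Sym_point_tensor [simp]:
  assumes "p \<in> Ar C" "q \<in> Ar C" "Dom C p = \<one>" "Dom C q = \<one>" "Cod C p = x" "Cod C q = y"
  shows "Sym C x y \<cdot> (p \<star> q) = q \<star> p"
proof -
  have "Sym C x y \<cdot> (p \<star> q) = (Sym C x y \<cdot> (p \<boxtimes> q)) \<cdot> inv_ar C (Lun C \<one>)"
    unfolding point_tensor_def using assms by auto
  then show ?thesis
    unfolding point_tensor_def using Sym_nat [of p q] assms by (simp add: Sym_Unit_Unit)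
qed

lemma inv_Asc_point_tensor [simp]:
  assumes "p \<in> Ar C" "q \<in> Ar C" "r \<in> Ar C" "Dom C p = \<one>" "Dom C q = \<one>" "Dom C r = \<one>"
    "Cod C p = x" "Cod C q = y" "Cod C r = z"
  shows "inv_ar C (Asc C x y z) \<cdot> (p \<star> (q \<star> r)) = (p \<star> q) \<star> r"
  using assms by (subst inv_ar_Cmp_eq_iff) auto

text \<open>
  Evaluation of a composite on a point in two steps, for composites whose factors are best kept
  apart.
\<close>

lemma Cmp_eval:
  assumes "f \<cdot> p = q" "g \<cdot> q = r"
    and "p \<in> Ar C" "f \<in> Ar C" "g \<in> Ar C" "Cod C p = Dom C f" "Cod C f = Dom C g"
  shows "(g \<cdot> f) \<cdot> p = r"
  using assms by simp

lemma middle_swap_typing [simp]: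
  assumes "w \<in> Ob C" "x \<in> Ob C" "y \<in> Ob C" "z \<in> Ob C"
  shows "middle_swap C w x y z \<in> Ar C" "Dom C (middle_swap C w x y z) = (w \<otimes> x) \<otimes> (y \<otimes> z)"
    "Cod C (middle_swap C w x y z) = (w \<otimes> y) \<otimes> (x \<otimes> z)"
  unfolding middle_swap_def using assms by simp_all

lemma middle_swap_point_tensor [simp]:
  assumes "p \<in> Ar C" "q \<in> Ar C" "r \<in> Ar C" "s \<in> Ar C"
    "Dom C p = \<one>" "Dom C q = \<one>" "Dom C r = \<one>" "Dom C s = \<one>"
    "Cod C p = w" "Cod C q = x" "Cod C r = y" "Cod C s = z"
  shows "middle_swap C w x y z \<cdot> ((p \<star> q) \<star> (r \<star> s)) = (p \<star> r) \<star> (q \<star> s)"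
proof -
  define m where "m = Asc C y x z \<cdot> (Sym C x y \<boxtimes> Idn C z) \<cdot> inv_ar C (Asc C x y z)"
  have Ob [simp]: "w \<in> Ob C" "x \<in> Ob C" "y \<in> Ob C" "z \<in> Ob C"
    using assms(9-) Cod_Ob assms(1-4) by blast+
  have m [simp]: "m \<in> Ar C" "Dom C m = x \<otimes> (y \<otimes> z)" "Cod C m = y \<otimes> (x \<otimes> z)"
    by (simp_all add: m_def)
  note [simp] = assms
  have "inv_ar C (Asc C x y z) \<cdot> (q \<star> (r \<star> s)) = (q \<star> r) \<star> s"
    by simp
  moreover have "(Sym C x y \<boxtimes> Idn C z) \<cdot> ((q \<star> r) \<star> s) = (r \<star> q) \<star> s"
    by simp
  moreover have "Asc C y x z \<cdot> ((r \<star> q) \<star> s) = r \<star> (q \<star> s)"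
    by simp
  ultimately have "m \<cdot> (q \<star> (r \<star> s)) = r \<star> (q \<star> s)"
    unfolding m_def by (simp del: TA_point_tensor)
  then have 2: "(Idn C w \<boxtimes> m) \<cdot> (p \<star> (q \<star> (r \<star> s))) = p \<star> (r \<star> (q \<star> s))"
    by simp
  have 1: "Asc C w x (y \<otimes> z) \<cdot> ((p \<star> q) \<star> (r \<star> s)) = p \<star> (q \<star> (r \<star> s))"
    by simp
  have 3: "inv_ar C (Asc C w y (x \<otimes> z)) \<cdot> (p \<star> (r \<star> (q \<star> s))) = (p \<star> r) \<star> (q \<star> s)"
    by simp
  show ?thesis
    unfolding middle_swap_def m_def [symmetric]
    by (rule Cmp_eval [OF Cmp_eval [OF 1 2] 3]) simp_all
qed

lemma Idn_Unit_point_tensor: "Idn C \<one> \<star> Idn C \<one> = inv_ar C (Lun C \<one>)"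
  unfolding point_tensor_def by simp

lemma generating_eqI:
  assumes "generating C x S" "f \<in> Ar C" "g \<in> Ar C" "Dom C f = x" "Dom C g = x" "Cod C f = Cod C g"
    and "\<And>p. p \<in> S \<Longrightarrow> f \<cdot> p = g \<cdot> p"
  shows "f = g"
  using assms unfolding generating_def hom_iff by blast

lemma generatingI:
  assumes "x \<in> Ob C" "\<And>p. p \<in> S \<Longrightarrow> p \<in> hom C \<one> x"
    and "\<And>f g. f \<in> Ar C \<Longrightarrow> g \<in> Ar C \<Longrightarrow> Dom C f = x \<Longrightarrow> Dom C g = x \<Longrightarrow> Cod C f = Cod C g
      \<Longrightarrow> (\<And>p. p \<in> S \<Longrightarrow> f \<cdot> p = g \<cdot> p) \<Longrightarrow> f = g"
  shows "generating C x S"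
  unfolding generating_def
proof (intro conjI allI impI subsetI)
  fix y f g
  assume "f \<in> hom C x y" "g \<in> hom C x y" "\<forall>p \<in> S. f \<cdot> p = g \<cdot> p"
  then show "f = g"
    by (metis assms(3) hom_iff)
qed (simp_all add: assms(1,2))

end

lemma coproduct_eqI:
  assumes "is_coproduct C Z F c i" "f \<in> hom C c y" "g \<in> hom C c y" "y \<in> Ob C"
    and "\<And>z. z \<in> Z \<Longrightarrow> f \<cdot>\<^bsub>C\<^esub> i z = g \<cdot>\<^bsub>C\<^esub> i z" "\<And>z. z \<in> Z \<Longrightarrow> g \<cdot>\<^bsub>C\<^esub> i z \<in> hom C (F z) y"
  shows "f = g"
proof -
  have "\<exists>!h. h \<in> hom C c y \<and> (\<forall>z\<in>Z. h \<cdot>\<^bsub>C\<^esub> i z = g \<cdot>\<^bsub>C\<^esub> i z)"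
    using assms unfolding is_coproduct_def by simp
  then show ?thesis using assms by blast
qed

locale unit_copower_category = symmetric_monoidal_category C
  for C :: "('o, 'a, 'm) smcat_scheme" (structure) +
  fixes \<kappa> :: "'k rel"
    and cop :: "('k, 'a) elts \<Rightarrow> 'o" and \<iota> :: "('k, 'a) elts \<Rightarrow> ('k, 'a) elt \<Rightarrow> 'a"
  assumes copowers: "unit_copowers C \<kappa> cop \<iota>"
    and tensor_preserves: "tensor_preserves_unit_copowers C \<kappa> cop \<iota>"
begin

lemma coproduct_cop: "|Z| <o \<kappa> \<Longrightarrow> is_coproduct C Z (\<lambda>z. \<one>) (cop Z) (\<iota> Z)"
  using copowers by (simp add: unit_copowers_def)

lemma coproduct_cop_TO:
  "|Z| <o \<kappa> \<Longrightarrow> x \<in> Ob C \<Longrightarrow>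
    is_coproduct C Z (\<lambda>z. \<one> \<otimes> x) (cop Z \<otimes> x) (\<lambda>z. \<iota> Z z \<boxtimes> Idn C x)"
  using tensor_preserves by (simp add: tensor_preserves_unit_copowers_def)

lemma cop_Ob [simp]: "|Z| <o \<kappa> \<Longrightarrow> cop Z \<in> Ob C"
  using coproduct_cop by (simp add: is_coproduct_def)

lemma \<iota>_typing [simp]:
  assumes "|Z| <o \<kappa>" "z \<in> Z"
  shows "\<iota> Z z \<in> Ar C" "Dom C (\<iota> Z z) = \<one>" "Cod C (\<iota> Z z) = cop Z"
  using coproduct_cop assms by (simp_all add: is_coproduct_def hom_iff)

lemma cop_universal:
  assumes "|Z| <o \<kappa>" "y \<in> Ob C" "\<And>z. z \<in> Z \<Longrightarrow> g z \<in> Ar C \<and> Dom C (g z) = \<one> \<and> Cod C (g z) = y"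
  shows "\<exists>!h. h \<in> hom C (cop Z) y \<and> (\<forall>z \<in> Z. h \<cdot> \<iota> Z z = g z)"
  using coproduct_cop [OF assms(1)] assms(2,3) unfolding is_coproduct_def by (simp add: hom_iff)

lemma generating_cop:
  assumes Z: "|Z| <o \<kappa>"
  shows "generating C (cop Z) (\<iota> Z ` Z)"
proof (rule generatingI)
  fix f g
  assume fg: "f \<in> Ar C" "g \<in> Ar C" "Dom C f = cop Z" "Dom C g = cop Z" "Cod C f = Cod C g"
    and eq: "\<And>p. p \<in> \<iota> Z ` Z \<Longrightarrow> f \<cdot> p = g \<cdot> p"
  show "f = g"
    by (rule coproduct_eqI [OF coproduct_cop [OF Z], where y = "Cod C g"])
       (use fg eq Z in \<open>auto simp: hom_iff\<close>)
qed (use Z in \<open>auto simp: hom_iff\<close>)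

text \<open>
  Because the tensor product preserves copowers of the unit, points of the form \<open>p \<star> q\<close> with \<open>p\<close> a
  coproduct injection suffice to separate maps out of a tensor product: restricting such a map
  along one injection gives a map out of the other factor.
\<close>

lemma generating_cop_TO:
  assumes Z: "|Z| <o \<kappa>" and gen: "generating C x T"
  shows "generating C (cop Z \<otimes> x) {\<iota> Z z \<star> q | z q. z \<in> Z \<and> q \<in> T}"
proof (rule generatingI)
  have x: "x \<in> Ob C" and T: "\<And>q. q \<in> T \<Longrightarrow> q \<in> Ar C \<and> Dom C q = \<one> \<and> Cod C q = x"
    using gen by (auto simp: generating_def hom_iff)
  then show "cop Z \<otimes> x \<in> Ob C"
    and "\<And>p. p \<in> {\<iota> Z z \<star> q | z q. z \<in> Z \<and> q \<in> T} \<Longrightarrow> p \<in> hom C \<one> (cop Z \<otimes> x)"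
    using Z by (auto simp: hom_iff)
  fix f g
  assume fg: "f \<in> Ar C" "g \<in> Ar C" "Dom C f = cop Z \<otimes> x" "Dom C g = cop Z \<otimes> x" "Cod C f = Cod C g"
    and eq: "\<And>p. p \<in> {\<iota> Z z \<star> q | z q. z \<in> Z \<and> q \<in> T} \<Longrightarrow> f \<cdot> p = g \<cdot> p"
  have "f \<cdot> (\<iota> Z z \<boxtimes> Idn C x) = g \<cdot> (\<iota> Z z \<boxtimes> Idn C x)" if z: "z \<in> Z" for z
  proof (rule iso_cancel_right [of "inv_ar C (Lun C x)"])
    show "is_iso C (inv_ar C (Lun C x))"
      unfolding is_iso_def inverse_arrows_def
      by (rule exI [of _ "Lun C x"]) (use x in \<open>simp add: hom_iff\<close>)
    show "(f \<cdot> (\<iota> Z z \<boxtimes> Idn C x)) \<cdot> inv_ar C (Lun C x) = (g \<cdot> (\<iota> Z z \<boxtimes> Idn C x)) \<cdot> inv_ar C (Lun C x)"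
    proof (rule generating_eqI [OF gen])
      fix q assume q: "q \<in> T"
      have "inv_ar C (Lun C x) \<cdot> q = Idn C \<one> \<star> q"
        using T [OF q] x by (subst inv_ar_Cmp_eq_iff) auto
      then show "((f \<cdot> (\<iota> Z z \<boxtimes> Idn C x)) \<cdot> inv_ar C (Lun C x)) \<cdot> q
          = ((g \<cdot> (\<iota> Z z \<boxtimes> Idn C x)) \<cdot> inv_ar C (Lun C x)) \<cdot> q"
        using T [OF q] x z Z fg eq [of "\<iota> Z z \<star> q"] q by auto
    qed (use fg x z Z in auto)
  qed (use fg x z Z in auto)
  then show "f = g"
    by (intro coproduct_eqI [OF coproduct_cop_TO [OF Z x], of f "Cod C g" g])
       (use fg x Z in \<open>auto simp: hom_iff\<close>)
qed

lemma generating_TO_cop: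
  assumes Z: "|Z| <o \<kappa>" and gen: "generating C x T"
  shows "generating C (x \<otimes> cop Z) {q \<star> \<iota> Z z | q z. q \<in> T \<and> z \<in> Z}"
proof (rule generatingI)
  have x: "x \<in> Ob C" and T: "\<And>q. q \<in> T \<Longrightarrow> q \<in> Ar C \<and> Dom C q = \<one> \<and> Cod C q = x"
    using gen by (auto simp: generating_def hom_iff)
  then show "x \<otimes> cop Z \<in> Ob C"
    and ty: "\<And>p. p \<in> {q \<star> \<iota> Z z | q z. q \<in> T \<and> z \<in> Z} \<Longrightarrow> p \<in> hom C \<one> (x \<otimes> cop Z)"
    using Z by (auto simp: hom_iff)
  fix f g
  assume fg: "f \<in> Ar C" "g \<in> Ar C" "Dom C f = x \<otimes> cop Z" "Dom C g = x \<otimes> cop Z" "Cod C f = Cod C g"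
    and eq: "\<And>p. p \<in> {q \<star> \<iota> Z z | q z. q \<in> T \<and> z \<in> Z} \<Longrightarrow> f \<cdot> p = g \<cdot> p"
  let ?s = "Sym C (cop Z) x"
  have "f \<cdot> ?s = g \<cdot> ?s"
  proof (rule generating_eqI [OF generating_cop_TO [OF Z gen]])
    fix p assume "p \<in> {\<iota> Z z \<star> q | z q. z \<in> Z \<and> q \<in> T}"
    then obtain z q where "p = \<iota> Z z \<star> q" "z \<in> Z" "q \<in> T" by blast
    then show "(f \<cdot> ?s) \<cdot> p = (g \<cdot> ?s) \<cdot> p"
      using T [of q] x Z fg eq [of "q \<star> \<iota> Z z"] by auto
  qed (use fg x Z in auto)
  moreover have "is_iso C ?s"
    unfolding is_iso_def inverse_arrows_def
    by (rule exI [of _ "Sym C x (cop Z)"]) (use x Z in \<open>simp add: hom_iff Sym_Sym\<close>)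
  ultimately show "f = g"
    by (elim iso_cancel_right [rotated]) (use fg x Z in auto)
qed

lemma generating_Unit_TO:
  assumes gen: "generating C x T"
  shows "generating C (\<one> \<otimes> x) {Idn C \<one> \<star> q | q. q \<in> T}"
proof (rule generatingI)
  have x: "x \<in> Ob C" and T: "\<And>q. q \<in> T \<Longrightarrow> q \<in> Ar C \<and> Dom C q = \<one> \<and> Cod C q = x"
    using gen by (auto simp: generating_def hom_iff)
  then show "\<one> \<otimes> x \<in> Ob C"
    and "\<And>p. p \<in> {Idn C \<one> \<star> q | q. q \<in> T} \<Longrightarrow> p \<in> hom C \<one> (\<one> \<otimes> x)"
    by (auto simp: hom_iff)
  fix f g
  assume fg: "f \<in> Ar C" "g \<in> Ar C" "Dom C f = \<one> \<otimes> x" "Dom C g = \<one> \<otimes> x" "Cod C f = Cod C g"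
    and eq: "\<And>p. p \<in> {Idn C \<one> \<star> q | q. q \<in> T} \<Longrightarrow> f \<cdot> p = g \<cdot> p"
  have inv: "inv_ar C (Lun C x) \<cdot> q = Idn C \<one> \<star> q" if "q \<in> T" for q
    using T [OF that] x by (subst inv_ar_Cmp_eq_iff) auto
  have "f \<cdot> inv_ar C (Lun C x) = g \<cdot> inv_ar C (Lun C x)"
    by (rule generating_eqI [OF gen]) (use fg x T inv eq in auto)
  then have "(f \<cdot> inv_ar C (Lun C x)) \<cdot> Lun C x = (g \<cdot> inv_ar C (Lun C x)) \<cdot> Lun C x"
    by simp
  then show "f = g"
    using fg x by simp
qed

lemma generating_TO_Unit:
  assumes gen: "generating C x T"
  shows "generating C (x \<otimes> \<one>) {q \<star> Idn C \<one> | q. q \<in> T}"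
proof (rule generatingI)
  have x: "x \<in> Ob C" and T: "\<And>q. q \<in> T \<Longrightarrow> q \<in> Ar C \<and> Dom C q = \<one> \<and> Cod C q = x"
    using gen by (auto simp: generating_def hom_iff)
  then show "x \<otimes> \<one> \<in> Ob C"
    and "\<And>p. p \<in> {q \<star> Idn C \<one> | q. q \<in> T} \<Longrightarrow> p \<in> hom C \<one> (x \<otimes> \<one>)"
    by (auto simp: hom_iff)
  fix f g
  assume fg: "f \<in> Ar C" "g \<in> Ar C" "Dom C f = x \<otimes> \<one>" "Dom C g = x \<otimes> \<one>" "Cod C f = Cod C g"
    and eq: "\<And>p. p \<in> {q \<star> Idn C \<one> | q. q \<in> T} \<Longrightarrow> f \<cdot> p = g \<cdot> p"
  have inv: "inv_ar C (Run C x) \<cdot> q = q \<star> Idn C \<one>" if "q \<in> T" for q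
    using T [OF that] x by (subst inv_ar_Cmp_eq_iff) auto
  have "f \<cdot> inv_ar C (Run C x) = g \<cdot> inv_ar C (Run C x)"
    by (rule generating_eqI [OF gen]) (use fg x T inv eq in auto)
  then have "(f \<cdot> inv_ar C (Run C x)) \<cdot> Run C x = (g \<cdot> inv_ar C (Run C x)) \<cdot> Run C x"
    by simp
  then show "f = g"
    using fg x by simp
qed

text \<open>
  The copower in the first variable reduces the construction to one map \<open>k z\<close> out of \<open>cop W\<close> for each
  \<open>z\<close>, which the copower in the second variable supplies.
\<close>

lemma cop_TO_cop_universal:
  assumes Z: "|Z| <o \<kappa>" and W: "|W| <o \<kappa>" and y: "y \<in> Ob C"
    and g: "\<And>z w. z \<in> Z \<Longrightarrow> w \<in> W \<Longrightarrow> g z w \<in> Ar C \<and> Dom C (g z w) = \<one> \<and> Cod C (g z w) = y"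
  shows "\<exists>!h. h \<in> hom C (cop Z \<otimes> cop W) y \<and> (\<forall>z \<in> Z. \<forall>w \<in> W. h \<cdot> (\<iota> Z z \<star> \<iota> W w) = g z w)"
proof -
  have "\<forall>z \<in> Z. \<exists>k. k \<in> hom C (cop W) y \<and> (\<forall>w \<in> W. k \<cdot> \<iota> W w = g z w)"
    using cop_universal [OF W y] g by blast
  then obtain k where k: "\<And>z. z \<in> Z \<Longrightarrow> k z \<in> Ar C \<and> Dom C (k z) = cop W \<and> Cod C (k z) = y"
    and kw: "\<And>z w. z \<in> Z \<Longrightarrow> w \<in> W \<Longrightarrow> k z \<cdot> \<iota> W w = g z w"
    unfolding hom_iff by metis
  have kL: "\<forall>z \<in> Z. k z \<cdot> Lun C (cop W) \<in> hom C (\<one> \<otimes> cop W) y"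
    using k W by (simp add: hom_iff)
  obtain h where h: "h \<in> hom C (cop Z \<otimes> cop W) y"
    and hz: "\<And>z. z \<in> Z \<Longrightarrow> h \<cdot> (\<iota> Z z \<boxtimes> Idn C (cop W)) = k z \<cdot> Lun C (cop W)"
  proof -
    have "\<exists>!h. h \<in> hom C (cop Z \<otimes> cop W) y \<and>
        (\<forall>z \<in> Z. h \<cdot> (\<iota> Z z \<boxtimes> Idn C (cop W)) = k z \<cdot> Lun C (cop W))"
      using coproduct_cop_TO [OF Z cop_Ob [OF W]] y kL unfolding is_coproduct_def
      by simp
    with that show thesis by blast
  qed
  have "h \<cdot> (\<iota> Z z \<star> \<iota> W w) = g z w" if "z \<in> Z" "w \<in> W" for z w
  proof -
    have "h \<cdot> (\<iota> Z z \<star> \<iota> W w) = (h \<cdot> (\<iota> Z z \<boxtimes> Idn C (cop W))) \<cdot> (Idn C \<one> \<star> \<iota> W w)"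
      using h that Z W by (simp add: hom_iff)
    also have "\<dots> = g z w"
      using k kw that Z W by (simp add: hz)
    finally show ?thesis .
  qed
  moreover have "h = h'"
    if "h' \<in> hom C (cop Z \<otimes> cop W) y" "\<forall>z \<in> Z. \<forall>w \<in> W. h' \<cdot> (\<iota> Z z \<star> \<iota> W w) = g z w" for h'
    by (rule generating_eqI [OF generating_cop_TO [OF Z generating_cop [OF W]]])
       (use h that calculation in \<open>auto simp: hom_iff\<close>)
  ultimately show ?thesis
    using h by blast
qed

text \<open>
  The extensionality principles for the domains that occur in the axioms of a lax monoidal functor.
\<close>

lemma cop_eqI:
  assumes "|Z| <o \<kappa>" "f \<in> Ar C" "g \<in> Ar C" "Dom C f = cop Z" "Dom C g = cop Z" "Cod C f = Cod C g"
    and "\<And>z. z \<in> Z \<Longrightarrow> f \<cdot> \<iota> Z z = g \<cdot> \<iota> Z z"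
  shows "f = g"
  by (rule generating_eqI [OF generating_cop]) (use assms in auto)

lemma cop_TO_cop_eqI:
  assumes "|Z| <o \<kappa>" "|W| <o \<kappa>" "f \<in> Ar C" "g \<in> Ar C"
    "Dom C f = cop Z \<otimes> cop W" "Dom C g = cop Z \<otimes> cop W" "Cod C f = Cod C g"
    and "\<And>z w. z \<in> Z \<Longrightarrow> w \<in> W \<Longrightarrow> f \<cdot> (\<iota> Z z \<star> \<iota> W w) = g \<cdot> (\<iota> Z z \<star> \<iota> W w)"
  shows "f = g"
  by (rule generating_eqI [OF generating_cop_TO [OF _ generating_cop]]) (use assms in auto)

lemma cop_TO_cop_TO_cop_eqI:
  assumes "|Z| <o \<kappa>" "|W| <o \<kappa>" "|V| <o \<kappa>" "f \<in> Ar C" "g \<in> Ar C"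
    "Dom C f = (cop Z \<otimes> cop W) \<otimes> cop V" "Dom C g = (cop Z \<otimes> cop W) \<otimes> cop V" "Cod C f = Cod C g"
    and "\<And>z w v. z \<in> Z \<Longrightarrow> w \<in> W \<Longrightarrow> v \<in> V
      \<Longrightarrow> f \<cdot> ((\<iota> Z z \<star> \<iota> W w) \<star> \<iota> V v) = g \<cdot> ((\<iota> Z z \<star> \<iota> W w) \<star> \<iota> V v)"
  shows "f = g"
  by (rule generating_eqI [OF generating_TO_cop [OF _ generating_cop_TO [OF _ generating_cop]]])
     (use assms in auto)

lemma Unit_TO_cop_eqI:
  assumes "|Z| <o \<kappa>" "f \<in> Ar C" "g \<in> Ar C" "Dom C f = \<one> \<otimes> cop Z" "Dom C g = \<one> \<otimes> cop Z"
    "Cod C f = Cod C g"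
    and "\<And>z. z \<in> Z \<Longrightarrow> f \<cdot> (Idn C \<one> \<star> \<iota> Z z) = g \<cdot> (Idn C \<one> \<star> \<iota> Z z)"
  shows "f = g"
  by (rule generating_eqI [OF generating_Unit_TO [OF generating_cop]]) (use assms in auto)

lemma cop_TO_Unit_eqI:
  assumes "|Z| <o \<kappa>" "f \<in> Ar C" "g \<in> Ar C" "Dom C f = cop Z \<otimes> \<one>" "Dom C g = cop Z \<otimes> \<one>"
    "Cod C f = Cod C g"
    and "\<And>z. z \<in> Z \<Longrightarrow> f \<cdot> (\<iota> Z z \<star> Idn C \<one>) = g \<cdot> (\<iota> Z z \<star> Idn C \<one>)"
  shows "f = g"
  by (rule generating_eqI [OF generating_TO_Unit [OF generating_cop]]) (use assms in auto)

end

section \<open>The symmetric monoidal category of small sets\<close>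

lemma mem_sprod_iff [simp]: "Pr a b \<in> sprod A B \<longleftrightarrow> a \<in> A \<and> b \<in> B"
  by (auto simp: sprod_def)

lemma ball_sprod_iff [simp]: "(\<forall>p \<in> sprod A B. P p) \<longleftrightarrow> (\<forall>a \<in> A. \<forall>b \<in> B. P (Pr a b))"
  by (auto simp: sprod_def)

lemma sfun_eq_iff [simp]: "sfun A f B = sfun A' g B' \<longleftrightarrow> A = A' \<and> B = B' \<and> (\<forall>a \<in> A. f a = g a)"
  by (auto simp: sfun_def restrict_def fun_eq_iff)

lemma SET_simps [simp]:
  "A \<in> Ob (SET \<kappa>) \<longleftrightarrow> |A| <o \<kappa>"
  "Dom (SET \<kappa>) (sfun A f B) = A"
  "Cod (SET \<kappa>) (sfun A f B) = B"
  "sfun A f B \<in> Ar (SET \<kappa>) \<longleftrightarrow> |A| <o \<kappa> \<and> |B| <o \<kappa> \<and> (\<forall>a \<in> A. f a \<in> B)"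
  "Idn (SET \<kappa>) A = sfun A (\<lambda>a. a) A"
  "Cmp (SET \<kappa>) (sfun B' g D) (sfun A f B) = sfun A (\<lambda>a. restrict g B' (restrict f A a)) D"
  "Unit (SET \<kappa>) = {Star}"
  "TO (SET \<kappa>) = sprod"
  "TA (SET \<kappa>) (sfun A f B) (sfun A' f' B')
    = sfun (sprod A A') (\<lambda>p. Pr (restrict f A (pr1 p)) (restrict f' A' (pr2 p))) (sprod B B')"
  "Asc (SET \<kappa>) A B D = sfun (sprod (sprod A B) D)
              (\<lambda>p. Pr (pr1 (pr1 p)) (Pr (pr2 (pr1 p)) (pr2 p))) (sprod A (sprod B D))"
  "Lun (SET \<kappa>) A = sfun (sprod {Star} A) pr2 A"
  "Run (SET \<kappa>) A = sfun (sprod A {Star}) pr1 A"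
  "Sym (SET \<kappa>) A B = sfun (sprod A B) (\<lambda>p. Pr (pr2 p) (pr1 p)) (sprod B A)"
  by (auto simp: SET_def sfun_def PiE_def Pi_iff)

text \<open>
  An arrow stores an extensional function, so it is restored by \<open>sfun\<close> from its underlying function.
\<close>

lemma SET_arrow_cases:
  assumes "x \<in> Ar (SET \<kappa>)"
  obtains A f B where "x = sfun A f B" "|A| <o \<kappa>" "|B| <o \<kappa>" "\<forall>a \<in> A. f a \<in> B"
proof -
  obtain A f B where "x = (A, f, B)" by (cases x)
  moreover from this assms have "f \<in> A \<rightarrow>\<^sub>E B" "|A| <o \<kappa>" "|B| <o \<kappa>" by (auto simp: SET_def)
  ultimately show thesis
    using that [of A f B] by (auto simp: sfun_def)
qed

lemma SET_hom_cases:
  assumes "x \<in> hom (SET \<kappa>) A B"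
  obtains f where "x = sfun A f B" "|A| <o \<kappa>" "|B| <o \<kappa>" "\<forall>a \<in> A. f a \<in> B"
proof -
  obtain A' f B' where "x = sfun A' f B'" "|A'| <o \<kappa>" "|B'| <o \<kappa>" "\<forall>a \<in> A'. f a \<in> B'"
    using assms SET_arrow_cases unfolding hom_iff by metis
  moreover from this assms have "A' = A" "B' = B" by (simp_all add: hom_iff)
  ultimately show thesis using that [of f] by simp
qed

locale infinite_cardinal =
  fixes \<kappa> :: "'k rel"
  assumes Card_order_\<kappa>: "Card_order \<kappa>" and infinite_Field_\<kappa>: "infinite (Field \<kappa>)"
begin

lemma finite_small:
  assumes "finite A"
  shows "|A| <o \<kappa>"
  by (rule finite_ordLess_infinite)
     (use assms Card_order_\<kappa> infinite_Field_\<kappa> card_of_Well_order card_order_on_well_order_on in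
       \<open>auto simp: Field_card_of\<close>)

lemma Unit_small [simp]: "|{Star}| <o \<kappa>"
  by (simp add: finite_small)

text \<open>
  An infinite product has the cardinality of its larger factor, and a finite one is small because
  \<open>\<kappa>\<close> is infinite.
\<close>

lemma sprod_small [simp]:
  assumes A: "|A| <o \<kappa>" and B: "|B| <o \<kappa>"
  shows "|sprod A B| <o \<kappa>"
proof -
  have "|A \<times> B| <o \<kappa>"
  proof (cases "finite A \<and> finite B")
    case True
    then show ?thesis by (simp add: finite_small)
  next
    case False
    have "|A \<times> B| \<le>o |B|" if "|A| \<le>o |B|"
      using False that card_of_ordLeq_finite [of A B]
      by (intro card_of_Times_ordLeq_infinite_Field)
        (auto simp: Field_card_of card_of_card_order_on card_of_refl ordIso_imp_ordLeq)
    moreover have "|A \<times> B| \<le>o |A|" if "|B| \<le>o |A|"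
      using False that card_of_ordLeq_finite [of B A]
      by (intro card_of_Times_ordLeq_infinite_Field)
        (auto simp: Field_card_of card_of_card_order_on card_of_refl ordIso_imp_ordLeq)
    ultimately show ?thesis
      using A B ordLeq_total [of "|A|" "|B|"] ordLeq_ordLess_trans card_of_Well_order by blast
  qed
  moreover have "sprod A B = (\<lambda>(a, b). Pr a b) ` (A \<times> B)"
    by (auto simp: sprod_def)
  ultimately show ?thesis
    using card_of_image ordLeq_ordLess_trans by metis
qed

lemma category_SET: "category (SET \<kappa>)"
proof
  show "Dom (SET \<kappa>) f \<in> Ob (SET \<kappa>)" "Cod (SET \<kappa>) f \<in> Ob (SET \<kappa>)" if "f \<in> Ar (SET \<kappa>)" for f :: "('k, 'a) sfun"
    using that by (auto elim!: SET_arrow_cases)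
qed (auto simp: hom_iff elim!: SET_hom_cases SET_arrow_cases)

lemma is_iso_SET:
  assumes "|A| <o \<kappa>" "|B| <o \<kappa>" "\<forall>a \<in> A. f a \<in> B \<and> g (f a) = a" "\<forall>b \<in> B. g b \<in> A \<and> f (g b) = b"
  shows "is_iso (SET \<kappa>) (sfun A f B)"
  unfolding is_iso_def inverse_arrows_def
  by (rule exI [of _ "sfun B g A"]) (use assms in \<open>simp add: hom_iff\<close>)

lemma symmetric_monoidal_category_SET: "symmetric_monoidal_category (SET \<kappa>)"
proof -
  interpret category "SET \<kappa>" by (rule category_SET)
  show ?thesis
  proof
    fix A B D :: "('k, 'a) elts"
    assume "A \<in> Ob (SET \<kappa>)" "B \<in> Ob (SET \<kappa>)" "D \<in> Ob (SET \<kappa>)"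
    then have AB: "|A| <o \<kappa>" "|B| <o \<kappa>" "|D| <o \<kappa>" by simp_all
    show "is_iso (SET \<kappa>) (Asc (SET \<kappa>) A B D)"
      unfolding SET_simps
      by (rule is_iso_SET [where g = "\<lambda>p. Pr (Pr (pr1 p) (pr1 (pr2 p))) (pr2 (pr2 p))"]) (use AB in simp_all)
  next
    fix A :: "('k, 'a) elts"
    assume "A \<in> Ob (SET \<kappa>)"
    then have A: "|A| <o \<kappa>" by simp_all
    show "is_iso (SET \<kappa>) (Lun (SET \<kappa>) A)"
      unfolding SET_simps
      by (rule is_iso_SET [where g = "Pr Star"]) (use A in simp_all)
    show "is_iso (SET \<kappa>) (Run (SET \<kappa>) A)"
      unfolding SET_simps
      by (rule is_iso_SET [where g = "\<lambda>a. Pr a Star"]) (use A in simp_all)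
  qed ((elim SET_hom_cases)?, simp add: hom_iff)+
qed

end

section \<open>Composites of lax monoidal functors\<close>

context cat_functor
begin

lemma FO_in_Ob [simp]: "x \<in> Ob C \<Longrightarrow> FO F x \<in> Ob D"
  by (rule FO_Ob)

lemma FA_typing [simp]:
  assumes "f \<in> Ar C"
  shows "FA F f \<in> Ar D" "Dom D (FA F f) = FO F (Dom C f)" "Cod D (FA F f) = FO F (Cod C f)"
  using FA_hom [of f "Dom C f" "Cod C f"] assms by (simp_all add: hom_iff)

lemma FA_functor [simp]:
  "x \<in> Ob C \<Longrightarrow> FA F (Idn C x) = Idn D (FO F x)"
  "f \<in> Ar C \<Longrightarrow> g \<in> Ar C \<Longrightarrow> Cod C f = Dom C g \<Longrightarrow> FA F (g \<cdot>\<^bsub>C\<^esub> f) = FA F g \<cdot>\<^bsub>D\<^esub> FA F f"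
  using FA_Id FA_Cmp [of f _ _ g] by (simp_all add: hom_iff)

end

context lax_symmetric_monoidal_functor
begin

lemma M0_typing [simp]:
  "M0 F \<in> Ar D" "Dom D (M0 F) = \<one>\<^bsub>D\<^esub>" "Cod D (M0 F) = FO F \<one>\<^bsub>C\<^esub>"
  using M0_hom by (simp_all add: hom_iff)

lemma M2_typing [simp]:
  assumes "x \<in> Ob C" "y \<in> Ob C"
  shows "M2 F x y \<in> Ar D" "Dom D (M2 F x y) = FO F x \<otimes>\<^bsub>D\<^esub> FO F y"
    "Cod D (M2 F x y) = FO F (x \<otimes>\<^bsub>C\<^esub> y)"
  using M2_hom assms by (simp_all add: hom_iff)

lemma M2_nat: "f \<in> Ar C \<Longrightarrow> g \<in> Ar C \<Longrightarrow>
   M2 F (Cod C f) (Cod C g) \<cdot>\<^bsub>D\<^esub> (FA F f \<boxtimes>\<^bsub>D\<^esub> FA F g)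
     = FA F (f \<boxtimes>\<^bsub>C\<^esub> g) \<cdot>\<^bsub>D\<^esub> M2 F (Dom C f) (Dom C g)"
  by (rule M2_natural) (simp_all add: hom_iff)

end

lemma id_mfunctor_simps [simp]:
  "FO (id_mfunctor C) x = x" "FA (id_mfunctor C) f = f" "M0 (id_mfunctor C) = Idn C \<one>\<^bsub>C\<^esub>"
  "M2 (id_mfunctor C) x y = Idn C (x \<otimes>\<^bsub>C\<^esub> y)"
  by (simp_all add: id_mfunctor_def)

lemma comp_mfunctor_simps [simp]:
  "FO (comp_mfunctor E G F) x = FO G (FO F x)" "FA (comp_mfunctor E G F) f = FA G (FA F f)"
  "M0 (comp_mfunctor E G F) = FA G (M0 F) \<cdot>\<^bsub>E\<^esub> M0 G"
  "M2 (comp_mfunctor E G F) x y = FA G (M2 F x y) \<cdot>\<^bsub>E\<^esub> M2 G (FO F x) (FO F y)"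
  by (simp_all add: comp_mfunctor_def)

lemma (in symmetric_monoidal_category) lax_id_mfunctor:
  "lax_symmetric_monoidal_functor C C (id_mfunctor C)"
  by unfold_locales (simp_all add: hom_iff)

text \<open>
  Each axiom for the composite follows by sliding the structure map of \<open>G\<close> past the image under \<open>G\<close> of
  that of \<open>F\<close>, by naturality, and then using the same axiom first for \<open>F\<close> inside \<open>G\<close> and then for
  \<open>G\<close>.
\<close>

lemma lax_comp_mfunctor:
  assumes "lax_symmetric_monoidal_functor C D F" "lax_symmetric_monoidal_functor D E G"
  shows "lax_symmetric_monoidal_functor C E (comp_mfunctor E G F)"
proof -
  interpret F: lax_symmetric_monoidal_functor C D F by fact
  interpret G: lax_symmetric_monoidal_functor D E G by fact
  interpret C: symmetric_monoidal_category C by unfold_locales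
  interpret D: symmetric_monoidal_category D by unfold_locales
  interpret E: symmetric_monoidal_category E by unfold_locales
  let ?H = "comp_mfunctor E G F"
  show ?thesis
  proof
    fix f g x x' y y' assume "f \<in> hom C x x'" "g \<in> hom C y y'"
    then have [simp]: "f \<in> Ar C" "Dom C f = x" "Cod C f = x'" "x \<in> Ob C" "x' \<in> Ob C"
      "g \<in> Ar C" "Dom C g = y" "Cod C g = y'" "y \<in> Ob C" "y' \<in> Ob C"
      by (auto simp: hom_iff)
    have m: "M2 F x' y' \<cdot>\<^bsub>D\<^esub> (FA F f \<boxtimes>\<^bsub>D\<^esub> FA F g) = FA F (f \<boxtimes>\<^bsub>C\<^esub> g) \<cdot>\<^bsub>D\<^esub> M2 F x y"
      using F.M2_nat [of f g] by simp
    have n: "M2 G (FO F x') (FO F y') \<cdot>\<^bsub>E\<^esub> (FA G (FA F f) \<boxtimes>\<^bsub>E\<^esub> FA G (FA F g))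
        = FA G (FA F f \<boxtimes>\<^bsub>D\<^esub> FA F g) \<cdot>\<^bsub>E\<^esub> M2 G (FO F x) (FO F y)"
      using G.M2_nat [of "FA F f" "FA F g"] by simp
    have "M2 ?H x' y' \<cdot>\<^bsub>E\<^esub> (FA ?H f \<boxtimes>\<^bsub>E\<^esub> FA ?H g)
        = FA G (M2 F x' y') \<cdot>\<^bsub>E\<^esub> (M2 G (FO F x') (FO F y') \<cdot>\<^bsub>E\<^esub> (FA G (FA F f) \<boxtimes>\<^bsub>E\<^esub> FA G (FA F g)))"
      by simp
    also have "\<dots> = FA G (M2 F x' y') \<cdot>\<^bsub>E\<^esub> (FA G (FA F f \<boxtimes>\<^bsub>D\<^esub> FA F g) \<cdot>\<^bsub>E\<^esub> M2 G (FO F x) (FO F y))"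
      by (simp only: n)
    also have "\<dots> = FA G (M2 F x' y' \<cdot>\<^bsub>D\<^esub> (FA F f \<boxtimes>\<^bsub>D\<^esub> FA F g)) \<cdot>\<^bsub>E\<^esub> M2 G (FO F x) (FO F y)"
      by simp
    also have "\<dots> = FA G (FA F (f \<boxtimes>\<^bsub>C\<^esub> g) \<cdot>\<^bsub>D\<^esub> M2 F x y) \<cdot>\<^bsub>E\<^esub> M2 G (FO F x) (FO F y)"
      by (simp only: m)
    finally show "M2 ?H x' y' \<cdot>\<^bsub>E\<^esub> (FA ?H f \<boxtimes>\<^bsub>E\<^esub> FA ?H g) = FA ?H (f \<boxtimes>\<^bsub>C\<^esub> g) \<cdot>\<^bsub>E\<^esub> M2 ?H x y"
      by simp
  next
    fix x y z assume [simp]: "x \<in> Ob C" "y \<in> Ob C" "z \<in> Ob C"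
    let ?X = "FO F x" and ?Y = "FO F y" and ?Z = "FO F z"
    let ?i = "\<lambda>x. Idn E (FO G (FO F x))"
    have n1: "M2 G (FO F (x \<otimes>\<^bsub>C\<^esub> y)) ?Z \<cdot>\<^bsub>E\<^esub> (FA G (M2 F x y) \<boxtimes>\<^bsub>E\<^esub> ?i z)
        = FA G (M2 F x y \<boxtimes>\<^bsub>D\<^esub> Idn D ?Z) \<cdot>\<^bsub>E\<^esub> M2 G (?X \<otimes>\<^bsub>D\<^esub> ?Y) ?Z"
      using G.M2_nat [of "M2 F x y" "Idn D ?Z"] by simp
    have n2: "FA G (Idn D ?X \<boxtimes>\<^bsub>D\<^esub> M2 F y z) \<cdot>\<^bsub>E\<^esub> M2 G ?X (?Y \<otimes>\<^bsub>D\<^esub> ?Z)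
        = M2 G ?X (FO F (y \<otimes>\<^bsub>C\<^esub> z)) \<cdot>\<^bsub>E\<^esub> (?i x \<boxtimes>\<^bsub>E\<^esub> FA G (M2 F y z))"
      using G.M2_nat [of "Idn D ?X" "M2 F y z"] by simp
    have "FA ?H (Asc C x y z) \<cdot>\<^bsub>E\<^esub> M2 ?H (x \<otimes>\<^bsub>C\<^esub> y) z \<cdot>\<^bsub>E\<^esub> (M2 ?H x y \<boxtimes>\<^bsub>E\<^esub> Idn E (FO ?H z))
      = FA G (FA F (Asc C x y z)) \<cdot>\<^bsub>E\<^esub> FA G (M2 F (x \<otimes>\<^bsub>C\<^esub> y) z) \<cdot>\<^bsub>E\<^esub>
        (M2 G (FO F (x \<otimes>\<^bsub>C\<^esub> y)) ?Z \<cdot>\<^bsub>E\<^esub> (FA G (M2 F x y) \<boxtimes>\<^bsub>E\<^esub> ?i z)) \<cdot>\<^bsub>E\<^esub> (M2 G ?X ?Y \<boxtimes>\<^bsub>E\<^esub> ?i z)"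
      by simp
    also have "\<dots> = FA G (FA F (Asc C x y z)) \<cdot>\<^bsub>E\<^esub> FA G (M2 F (x \<otimes>\<^bsub>C\<^esub> y) z) \<cdot>\<^bsub>E\<^esub>
        (FA G (M2 F x y \<boxtimes>\<^bsub>D\<^esub> Idn D ?Z) \<cdot>\<^bsub>E\<^esub> M2 G (?X \<otimes>\<^bsub>D\<^esub> ?Y) ?Z) \<cdot>\<^bsub>E\<^esub> (M2 G ?X ?Y \<boxtimes>\<^bsub>E\<^esub> ?i z)"
      by (simp only: n1)
    also have "\<dots> = FA G (FA F (Asc C x y z) \<cdot>\<^bsub>D\<^esub> M2 F (x \<otimes>\<^bsub>C\<^esub> y) z \<cdot>\<^bsub>D\<^esub> (M2 F x y \<boxtimes>\<^bsub>D\<^esub> Idn D ?Z)) \<cdot>\<^bsub>E\<^esub>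
        M2 G (?X \<otimes>\<^bsub>D\<^esub> ?Y) ?Z \<cdot>\<^bsub>E\<^esub> (M2 G ?X ?Y \<boxtimes>\<^bsub>E\<^esub> ?i z)"
      by simp
    also have "\<dots> = FA G (M2 F x (y \<otimes>\<^bsub>C\<^esub> z) \<cdot>\<^bsub>D\<^esub> (Idn D ?X \<boxtimes>\<^bsub>D\<^esub> M2 F y z) \<cdot>\<^bsub>D\<^esub> Asc D ?X ?Y ?Z) \<cdot>\<^bsub>E\<^esub>
        M2 G (?X \<otimes>\<^bsub>D\<^esub> ?Y) ?Z \<cdot>\<^bsub>E\<^esub> (M2 G ?X ?Y \<boxtimes>\<^bsub>E\<^esub> ?i z)"
      by (simp only: F.M2_Asc \<open>x \<in> Ob C\<close> \<open>y \<in> Ob C\<close> \<open>z \<in> Ob C\<close>)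
    also have "\<dots> = FA G (M2 F x (y \<otimes>\<^bsub>C\<^esub> z)) \<cdot>\<^bsub>E\<^esub> FA G (Idn D ?X \<boxtimes>\<^bsub>D\<^esub> M2 F y z) \<cdot>\<^bsub>E\<^esub>
        (FA G (Asc D ?X ?Y ?Z) \<cdot>\<^bsub>E\<^esub> M2 G (?X \<otimes>\<^bsub>D\<^esub> ?Y) ?Z \<cdot>\<^bsub>E\<^esub> (M2 G ?X ?Y \<boxtimes>\<^bsub>E\<^esub> ?i z))"
      by simp
    also have "\<dots> = FA G (M2 F x (y \<otimes>\<^bsub>C\<^esub> z)) \<cdot>\<^bsub>E\<^esub> FA G (Idn D ?X \<boxtimes>\<^bsub>D\<^esub> M2 F y z) \<cdot>\<^bsub>E\<^esub>
        (M2 G ?X (?Y \<otimes>\<^bsub>D\<^esub> ?Z) \<cdot>\<^bsub>E\<^esub> (?i x \<boxtimes>\<^bsub>E\<^esub> M2 G ?Y ?Z) \<cdot>\<^bsub>E\<^esub> Asc E (FO G ?X) (FO G ?Y) (FO G ?Z))"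
      by (simp only: G.M2_Asc F.FO_Ob \<open>x \<in> Ob C\<close> \<open>y \<in> Ob C\<close> \<open>z \<in> Ob C\<close>)
    also have "\<dots> = FA G (M2 F x (y \<otimes>\<^bsub>C\<^esub> z)) \<cdot>\<^bsub>E\<^esub> (FA G (Idn D ?X \<boxtimes>\<^bsub>D\<^esub> M2 F y z) \<cdot>\<^bsub>E\<^esub>
        M2 G ?X (?Y \<otimes>\<^bsub>D\<^esub> ?Z)) \<cdot>\<^bsub>E\<^esub> (?i x \<boxtimes>\<^bsub>E\<^esub> M2 G ?Y ?Z) \<cdot>\<^bsub>E\<^esub> Asc E (FO G ?X) (FO G ?Y) (FO G ?Z)"
      by simp
    also have "\<dots> = FA G (M2 F x (y \<otimes>\<^bsub>C\<^esub> z)) \<cdot>\<^bsub>E\<^esub> (M2 G ?X (FO F (y \<otimes>\<^bsub>C\<^esub> z)) \<cdot>\<^bsub>E\<^esub>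
        (?i x \<boxtimes>\<^bsub>E\<^esub> FA G (M2 F y z))) \<cdot>\<^bsub>E\<^esub> (?i x \<boxtimes>\<^bsub>E\<^esub> M2 G ?Y ?Z) \<cdot>\<^bsub>E\<^esub> Asc E (FO G ?X) (FO G ?Y) (FO G ?Z)"
      by (simp only: n2)
    also have "\<dots> = M2 ?H x (y \<otimes>\<^bsub>C\<^esub> z) \<cdot>\<^bsub>E\<^esub> (Idn E (FO ?H x) \<boxtimes>\<^bsub>E\<^esub> M2 ?H y z) \<cdot>\<^bsub>E\<^esub> Asc E (FO ?H x) (FO ?H y) (FO ?H z)"
      by simp
    finally show "FA ?H (Asc C x y z) \<cdot>\<^bsub>E\<^esub> M2 ?H (x \<otimes>\<^bsub>C\<^esub> y) z \<cdot>\<^bsub>E\<^esub> (M2 ?H x y \<boxtimes>\<^bsub>E\<^esub> Idn E (FO ?H z)) =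
        M2 ?H x (y \<otimes>\<^bsub>C\<^esub> z) \<cdot>\<^bsub>E\<^esub> (Idn E (FO ?H x) \<boxtimes>\<^bsub>E\<^esub> M2 ?H y z) \<cdot>\<^bsub>E\<^esub> Asc E (FO ?H x) (FO ?H y) (FO ?H z)" .
  next
    fix x assume [simp]: "x \<in> Ob C"
    let ?X = "FO F x" and ?i = "Idn E (FO G (FO F x))"
    have n: "M2 G (FO F \<one>\<^bsub>C\<^esub>) ?X \<cdot>\<^bsub>E\<^esub> (FA G (M0 F) \<boxtimes>\<^bsub>E\<^esub> ?i)
        = FA G (M0 F \<boxtimes>\<^bsub>D\<^esub> Idn D ?X) \<cdot>\<^bsub>E\<^esub> M2 G \<one>\<^bsub>D\<^esub> ?X"
      using G.M2_nat [of "M0 F" "Idn D ?X"] by simp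
    have "FA ?H (Lun C x) \<cdot>\<^bsub>E\<^esub> M2 ?H \<one>\<^bsub>C\<^esub> x \<cdot>\<^bsub>E\<^esub> (M0 ?H \<boxtimes>\<^bsub>E\<^esub> Idn E (FO ?H x))
      = FA G (FA F (Lun C x)) \<cdot>\<^bsub>E\<^esub> FA G (M2 F \<one>\<^bsub>C\<^esub> x) \<cdot>\<^bsub>E\<^esub>
        (M2 G (FO F \<one>\<^bsub>C\<^esub>) ?X \<cdot>\<^bsub>E\<^esub> (FA G (M0 F) \<boxtimes>\<^bsub>E\<^esub> ?i)) \<cdot>\<^bsub>E\<^esub> (M0 G \<boxtimes>\<^bsub>E\<^esub> ?i)"
      by simp
    also have "\<dots> = FA G (FA F (Lun C x)) \<cdot>\<^bsub>E\<^esub> FA G (M2 F \<one>\<^bsub>C\<^esub> x) \<cdot>\<^bsub>E\<^esub>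
        (FA G (M0 F \<boxtimes>\<^bsub>D\<^esub> Idn D ?X) \<cdot>\<^bsub>E\<^esub> M2 G \<one>\<^bsub>D\<^esub> ?X) \<cdot>\<^bsub>E\<^esub> (M0 G \<boxtimes>\<^bsub>E\<^esub> ?i)"
      by (simp only: n)
    also have "\<dots> = FA G (FA F (Lun C x) \<cdot>\<^bsub>D\<^esub> M2 F \<one>\<^bsub>C\<^esub> x \<cdot>\<^bsub>D\<^esub> (M0 F \<boxtimes>\<^bsub>D\<^esub> Idn D ?X)) \<cdot>\<^bsub>E\<^esub>
        M2 G \<one>\<^bsub>D\<^esub> ?X \<cdot>\<^bsub>E\<^esub> (M0 G \<boxtimes>\<^bsub>E\<^esub> ?i)"
      by simp
    also have "\<dots> = Lun E (FO ?H x)"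
      by (simp only: F.M2_Lun G.M2_Lun F.FO_Ob comp_mfunctor_simps \<open>x \<in> Ob C\<close>)
    finally show "FA ?H (Lun C x) \<cdot>\<^bsub>E\<^esub> M2 ?H \<one>\<^bsub>C\<^esub> x \<cdot>\<^bsub>E\<^esub> (M0 ?H \<boxtimes>\<^bsub>E\<^esub> Idn E (FO ?H x)) = Lun E (FO ?H x)" .
    have n: "M2 G ?X (FO F \<one>\<^bsub>C\<^esub>) \<cdot>\<^bsub>E\<^esub> (?i \<boxtimes>\<^bsub>E\<^esub> FA G (M0 F))
        = FA G (Idn D ?X \<boxtimes>\<^bsub>D\<^esub> M0 F) \<cdot>\<^bsub>E\<^esub> M2 G ?X \<one>\<^bsub>D\<^esub>"
      using G.M2_nat [of "Idn D ?X" "M0 F"] by simp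
    have "FA ?H (Run C x) \<cdot>\<^bsub>E\<^esub> M2 ?H x \<one>\<^bsub>C\<^esub> \<cdot>\<^bsub>E\<^esub> (Idn E (FO ?H x) \<boxtimes>\<^bsub>E\<^esub> M0 ?H)
      = FA G (FA F (Run C x)) \<cdot>\<^bsub>E\<^esub> FA G (M2 F x \<one>\<^bsub>C\<^esub>) \<cdot>\<^bsub>E\<^esub>
        (M2 G ?X (FO F \<one>\<^bsub>C\<^esub>) \<cdot>\<^bsub>E\<^esub> (?i \<boxtimes>\<^bsub>E\<^esub> FA G (M0 F))) \<cdot>\<^bsub>E\<^esub> (?i \<boxtimes>\<^bsub>E\<^esub> M0 G)"
      by simp
    also have "\<dots> = FA G (FA F (Run C x)) \<cdot>\<^bsub>E\<^esub> FA G (M2 F x \<one>\<^bsub>C\<^esub>) \<cdot>\<^bsub>E\<^esub>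
        (FA G (Idn D ?X \<boxtimes>\<^bsub>D\<^esub> M0 F) \<cdot>\<^bsub>E\<^esub> M2 G ?X \<one>\<^bsub>D\<^esub>) \<cdot>\<^bsub>E\<^esub> (?i \<boxtimes>\<^bsub>E\<^esub> M0 G)"
      by (simp only: n)
    also have "\<dots> = FA G (FA F (Run C x) \<cdot>\<^bsub>D\<^esub> M2 F x \<one>\<^bsub>C\<^esub> \<cdot>\<^bsub>D\<^esub> (Idn D ?X \<boxtimes>\<^bsub>D\<^esub> M0 F)) \<cdot>\<^bsub>E\<^esub>
        M2 G ?X \<one>\<^bsub>D\<^esub> \<cdot>\<^bsub>E\<^esub> (?i \<boxtimes>\<^bsub>E\<^esub> M0 G)"
      by simp
    also have "\<dots> = Run E (FO ?H x)"
      by (simp only: F.M2_Run G.M2_Run F.FO_Ob comp_mfunctor_simps \<open>x \<in> Ob C\<close>)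
    finally show "FA ?H (Run C x) \<cdot>\<^bsub>E\<^esub> M2 ?H x \<one>\<^bsub>C\<^esub> \<cdot>\<^bsub>E\<^esub> (Idn E (FO ?H x) \<boxtimes>\<^bsub>E\<^esub> M0 ?H) = Run E (FO ?H x)" .
  next
    fix x y assume [simp]: "x \<in> Ob C" "y \<in> Ob C"
    let ?X = "FO F x" and ?Y = "FO F y"
    have "FA ?H (Sym C x y) \<cdot>\<^bsub>E\<^esub> M2 ?H x y = FA G (FA F (Sym C x y) \<cdot>\<^bsub>D\<^esub> M2 F x y) \<cdot>\<^bsub>E\<^esub> M2 G ?X ?Y"
      by simp
    also have "\<dots> = FA G (M2 F y x \<cdot>\<^bsub>D\<^esub> Sym D ?X ?Y) \<cdot>\<^bsub>E\<^esub> M2 G ?X ?Y"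
      by (simp only: F.M2_Sym \<open>x \<in> Ob C\<close> \<open>y \<in> Ob C\<close>)
    also have "\<dots> = FA G (M2 F y x) \<cdot>\<^bsub>E\<^esub> (FA G (Sym D ?X ?Y) \<cdot>\<^bsub>E\<^esub> M2 G ?X ?Y)"
      by simp
    also have "\<dots> = FA G (M2 F y x) \<cdot>\<^bsub>E\<^esub> (M2 G ?Y ?X \<cdot>\<^bsub>E\<^esub> Sym E (FO G ?X) (FO G ?Y))"
      by (simp only: G.M2_Sym F.FO_Ob \<open>x \<in> Ob C\<close> \<open>y \<in> Ob C\<close>)
    finally show "FA ?H (Sym C x y) \<cdot>\<^bsub>E\<^esub> M2 ?H x y = M2 ?H y x \<cdot>\<^bsub>E\<^esub> Sym E (FO ?H x) (FO ?H y)"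
      by simp
  qed (simp_all add: hom_iff)
qed

section \<open>The adjunction between points and copowers of the unit\<close>

lemma mem_points_iff [simp]: "Arrow f \<in> points C x \<longleftrightarrow> f \<in> Ar C \<and> Dom C f = \<one>\<^bsub>C\<^esub> \<and> Cod C f = x"
  by (auto simp: points_def hom_iff)

lemma ball_points_iff [simp]:
  "(\<forall>p \<in> points C x. P p) \<longleftrightarrow> (\<forall>f. f \<in> Ar C \<and> Dom C f = \<one>\<^bsub>C\<^esub> \<and> Cod C f = x \<longrightarrow> P (Arrow f))"
  by (auto simp: points_def hom_iff)

lemma points_functor_simps [simp]:
  "FO (points_functor C) x = points C x"
  "FA (points_functor C) f
    = sfun (points C (Dom C f)) (\<lambda>p. Arrow (f \<cdot>\<^bsub>C\<^esub> the_Arrow p)) (points C (Cod C f))"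
  "M0 (points_functor C) = sfun {Star} (\<lambda>p. Arrow (Idn C \<one>\<^bsub>C\<^esub>)) (points C \<one>\<^bsub>C\<^esub>)"
  "M2 (points_functor C) x y = sfun (sprod (points C x) (points C y))
     (\<lambda>p. Arrow (the_Arrow (pr1 p) \<star>\<^bsub>C\<^esub> the_Arrow (pr2 p))) (points C (x \<otimes>\<^bsub>C\<^esub> y))"
  by (simp_all add: points_functor_def point_tensor_def)

lemma points_cases:
  assumes "p \<in> points C x"
  obtains f where "p = Arrow f" "f \<in> Ar C" "Dom C f = \<one>\<^bsub>C\<^esub>" "Cod C f = x"
  using assms by (auto simp: points_def hom_iff)

locale small_unit_copower_category = unit_copower_category C \<kappa> cop \<iota> + infinite_cardinal \<kappa>
  for C :: "('o, 'a, 'm) smcat_scheme" (structure) and \<kappa> :: "'k rel"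
    and cop :: "('k, 'a) elts \<Rightarrow> 'o" and \<iota> :: "('k, 'a) elts \<Rightarrow> ('k, 'a) elt \<Rightarrow> 'a" +
  assumes small_hom_Unit: "x \<in> Ob C \<Longrightarrow> |hom C \<one> x| <o \<kappa>"
begin

abbreviation "L \<equiv> copower_functor C cop \<iota>"
abbreviation R :: "('o, 'a, ('k, 'a) elts, ('k, 'a) sfun) mfunctor" where "R \<equiv> points_functor C"
abbreviation "\<eta> \<equiv> copower_unit C cop \<iota>"
abbreviation "\<epsilon> \<equiv> copower_counit C cop \<iota>"

lemma points_small [simp]: "x \<in> Ob C \<Longrightarrow> |points C x :: ('k, 'a) elts| <o \<kappa>"
  unfolding points_def using small_hom_Unit card_of_image ordLeq_ordLess_trans by metis

lemma cop_points_eqI: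
  assumes "f \<in> Ar C" "g \<in> Ar C" "Dom C f = cop (points C x)" "Dom C g = cop (points C x)"
    "Cod C f = Cod C g" "x \<in> Ob C"
    and eq: "\<And>p. p \<in> Ar C \<Longrightarrow> Dom C p = \<one> \<Longrightarrow> Cod C p = x
      \<Longrightarrow> f \<cdot> \<iota> (points C x) (Arrow p) = g \<cdot> \<iota> (points C x) (Arrow p)"
  shows "f = g"
proof (rule cop_eqI [of "points C x"])
  fix p :: "('k, 'a) elt" assume "p \<in> points C x"
  then show "f \<cdot> \<iota> (points C x) p = g \<cdot> \<iota> (points C x) p"
    by (rule points_cases) (simp add: eq)
qed (use assms(1-6) in simp_all)

lemma cop_points_TO_cop_points_eqI:
  assumes "f \<in> Ar C" "g \<in> Ar C" "Dom C f = cop (points C x) \<otimes> cop (points C y)"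
    "Dom C g = cop (points C x) \<otimes> cop (points C y)" "Cod C f = Cod C g" "x \<in> Ob C" "y \<in> Ob C"
    and eq: "\<And>p q. p \<in> Ar C \<Longrightarrow> Dom C p = \<one> \<Longrightarrow> Cod C p = x
      \<Longrightarrow> q \<in> Ar C \<Longrightarrow> Dom C q = \<one> \<Longrightarrow> Cod C q = y
      \<Longrightarrow> f \<cdot> (\<iota> (points C x) (Arrow p) \<star> \<iota> (points C y) (Arrow q))
        = g \<cdot> (\<iota> (points C x) (Arrow p) \<star> \<iota> (points C y) (Arrow q))"
  shows "f = g"
proof (rule cop_TO_cop_eqI [of "points C x" "points C y"])
  fix p q :: "('k, 'a) elt" assume "p \<in> points C x" "q \<in> points C y"
  then show "f \<cdot> (\<iota> (points C x) p \<star> \<iota> (points C y) q) = g \<cdot> (\<iota> (points C x) p \<star> \<iota> (points C y) q)"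
    by (elim points_cases) (simp add: eq)
qed (use assms(1-7) in simp_all)

sublocale SET: symmetric_monoidal_category "SET \<kappa> :: (('k, 'a) elts, ('k, 'a) sfun) smcat"
  by (rule symmetric_monoidal_category_SET)

lemma lax_points_functor: "lax_symmetric_monoidal_functor C (SET \<kappa>) R"
  by unfold_locales (simp_all add: hom_iff)

lemma FO_L [simp]: "FO L = cop"
  by (simp add: copower_functor_def)

lemma M0_L [simp]: "M0 L = \<iota> {Star} Star"
  by (simp add: copower_functor_def)

lemma FA_L [simp]:
  assumes "|Z| <o \<kappa>" "|W| <o \<kappa>" "\<forall>z \<in> Z. f z \<in> W"
  shows "FA L (sfun Z f W) \<in> Ar C" "Dom C (FA L (sfun Z f W)) = cop Z"
    "Cod C (FA L (sfun Z f W)) = cop W"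
    "z \<in> Z \<Longrightarrow> FA L (sfun Z f W) \<cdot> \<iota> Z z = \<iota> W (f z)"
proof -
  have "\<exists>!h. h \<in> hom C (cop Z) (cop W) \<and> (\<forall>z \<in> Z. h \<cdot> \<iota> Z z = \<iota> W (restrict f Z z))"
    using assms by (intro cop_universal) auto
  from theI' [OF this] assms
  show "FA L (sfun Z f W) \<in> Ar C" "Dom C (FA L (sfun Z f W)) = cop Z"
    "Cod C (FA L (sfun Z f W)) = cop W"
    "z \<in> Z \<Longrightarrow> FA L (sfun Z f W) \<cdot> \<iota> Z z = \<iota> W (f z)"
    by (simp_all add: copower_functor_def sfun_def hom_iff)
qed

text \<open>
  Translates the defining property of the structure map of the copower functor, which speaks about
  the tensor square of the unit, into one about points.
\<close>

lemma Cmp_TA_eq_iff_Cmp_point_tensor: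
  assumes "h \<in> Ar C" "p \<in> Ar C" "q \<in> Ar C" "r \<in> Ar C" "Dom C p = \<one>" "Dom C q = \<one>" "Dom C r = \<one>"
    "Dom C h = Cod C p \<otimes> Cod C q"
  shows "h \<cdot> (p \<boxtimes> q) = r \<cdot> Lun C \<one> \<longleftrightarrow> h \<cdot> (p \<star> q) = r"
proof
  assume "h \<cdot> (p \<boxtimes> q) = r \<cdot> Lun C \<one>"
  then have "(h \<cdot> (p \<boxtimes> q)) \<cdot> inv_ar C (Lun C \<one>) = (r \<cdot> Lun C \<one>) \<cdot> inv_ar C (Lun C \<one>)"
    by simp
  then show "h \<cdot> (p \<star> q) = r"
    unfolding point_tensor_def using assms by simp
next
  assume "h \<cdot> (p \<star> q) = r"
  then have "(h \<cdot> (p \<star> q)) \<cdot> Lun C \<one> = r \<cdot> Lun C \<one>"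
    by simp
  then show "h \<cdot> (p \<boxtimes> q) = r \<cdot> Lun C \<one>"
    unfolding point_tensor_def using assms by simp
qed

lemma M2_L [simp]:
  assumes Z: "|Z| <o \<kappa>" and W: "|W| <o \<kappa>"
  shows "M2 L Z W \<in> Ar C" "Dom C (M2 L Z W) = cop Z \<otimes> cop W" "Cod C (M2 L Z W) = cop (sprod Z W)"
    "z \<in> Z \<Longrightarrow> w \<in> W \<Longrightarrow> M2 L Z W \<cdot> (\<iota> Z z \<star> \<iota> W w) = \<iota> (sprod Z W) (Pr z w)"
proof -
  have "\<exists>!h. h \<in> hom C (cop Z \<otimes> cop W) (cop (sprod Z W)) \<and>
      (\<forall>z \<in> Z. \<forall>w \<in> W. h \<cdot> (\<iota> Z z \<star> \<iota> W w) = \<iota> (sprod Z W) (Pr z w))"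
    using Z W by (intro cop_TO_cop_universal) auto
  also have "(\<lambda>h. h \<in> hom C (cop Z \<otimes> cop W) (cop (sprod Z W)) \<and>
      (\<forall>z \<in> Z. \<forall>w \<in> W. h \<cdot> (\<iota> Z z \<star> \<iota> W w) = \<iota> (sprod Z W) (Pr z w)))
    = (\<lambda>h. h \<in> hom C (cop Z \<otimes> cop W) (cop (sprod Z W)) \<and>
      (\<forall>z \<in> Z. \<forall>w \<in> W. h \<cdot> (\<iota> Z z \<boxtimes> \<iota> W w) = \<iota> (sprod Z W) (Pr z w) \<cdot> Lun C \<one>))"
    using Z W by (intro ext conj_cong ball_cong refl) (simp_all add: Cmp_TA_eq_iff_Cmp_point_tensor hom_iff)
  finally have ex: "\<exists>!h. h \<in> hom C (cop Z \<otimes> cop W) (cop (sprod Z W)) \<and>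
      (\<forall>z \<in> Z. \<forall>w \<in> W. h \<cdot> (\<iota> Z z \<boxtimes> \<iota> W w) = \<iota> (sprod Z W) (Pr z w) \<cdot> Lun C \<one>)" .
  from theI' [OF ex] have "M2 L Z W \<in> hom C (cop Z \<otimes> cop W) (cop (sprod Z W)) \<and>
      (\<forall>z \<in> Z. \<forall>w \<in> W. M2 L Z W \<cdot> (\<iota> Z z \<boxtimes> \<iota> W w) = \<iota> (sprod Z W) (Pr z w) \<cdot> Lun C \<one>)"
    by (simp add: copower_functor_def)
  then show "M2 L Z W \<in> Ar C" "Dom C (M2 L Z W) = cop Z \<otimes> cop W" "Cod C (M2 L Z W) = cop (sprod Z W)"
    "z \<in> Z \<Longrightarrow> w \<in> W \<Longrightarrow> M2 L Z W \<cdot> (\<iota> Z z \<star> \<iota> W w) = \<iota> (sprod Z W) (Pr z w)"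
    using Z W by (auto simp: hom_iff Cmp_TA_eq_iff_Cmp_point_tensor)
qed

text \<open>
  On injections, each axiom reduces to the corresponding identity between elements of sets: the
  structure maps send \<open>\<iota> Z z \<star> \<iota> W w\<close> to the injection at the pair of \<open>z\<close> and \<open>w\<close>.
\<close>

lemma lax_copower_functor: "lax_symmetric_monoidal_functor (SET \<kappa>) C L"
proof
  fix f g :: "('k, 'a) sfun" and Z W V
  assume "f \<in> hom (SET \<kappa>) Z W" "g \<in> hom (SET \<kappa>) W V"
  then show "FA L (g \<cdot>\<^bsub>SET \<kappa>\<^esub> f) = FA L g \<cdot> FA L f"
    by - (elim SET_hom_cases, rule cop_eqI [of Z], simp_all)
next
  fix f g :: "('k, 'a) sfun" and Z W Z' W'
  assume "f \<in> hom (SET \<kappa>) Z Z'" "g \<in> hom (SET \<kappa>) W W'"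
  then show "M2 L Z' W' \<cdot> (FA L f \<boxtimes> FA L g) = FA L (f \<boxtimes>\<^bsub>SET \<kappa>\<^esub> g) \<cdot> M2 L Z W"
    by - (elim SET_hom_cases, rule cop_TO_cop_eqI [of Z W], simp_all)
next
  fix Z W V :: "('k, 'a) elts"
  assume "Z \<in> Ob (SET \<kappa>)" "W \<in> Ob (SET \<kappa>)" "V \<in> Ob (SET \<kappa>)"
  then show "FA L (Asc (SET \<kappa>) Z W V) \<cdot> M2 L (Z \<otimes>\<^bsub>SET \<kappa>\<^esub> W) V \<cdot> (M2 L Z W \<boxtimes> Idn C (FO L V)) =
        M2 L Z (W \<otimes>\<^bsub>SET \<kappa>\<^esub> V) \<cdot> (Idn C (FO L Z) \<boxtimes> M2 L W V) \<cdot> Asc C (FO L Z) (FO L W) (FO L V)"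
    by - (rule cop_TO_cop_TO_cop_eqI [of Z W V], simp_all)
next
  fix Z :: "('k, 'a) elts"
  assume Z: "Z \<in> Ob (SET \<kappa>)"
  from Z show "FA L (Idn (SET \<kappa>) Z) = Idn C (FO L Z)"
    by - (rule cop_eqI [of Z], simp_all)
  from Z show "FA L (Lun (SET \<kappa>) Z) \<cdot> M2 L \<one>\<^bsub>SET \<kappa>\<^esub> Z \<cdot> (M0 L \<boxtimes> Idn C (FO L Z)) = Lun C (FO L Z)"
    by - (rule Unit_TO_cop_eqI [of Z], simp_all)
  from Z show "FA L (Run (SET \<kappa>) Z) \<cdot> M2 L Z \<one>\<^bsub>SET \<kappa>\<^esub> \<cdot> (Idn C (FO L Z) \<boxtimes> M0 L) = Run C (FO L Z)"
    by - (rule cop_TO_Unit_eqI [of Z], simp_all)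
next
  fix Z W :: "('k, 'a) elts"
  assume "Z \<in> Ob (SET \<kappa>)" "W \<in> Ob (SET \<kappa>)"
  then show "FA L (Sym (SET \<kappa>) Z W) \<cdot> M2 L Z W = M2 L W Z \<cdot> Sym C (FO L Z) (FO L W)"
    by - (rule cop_TO_cop_eqI [of Z W], simp_all)
qed ((elim SET_hom_cases)?, simp add: hom_iff)+

lemma \<eta>_eq [simp]: "\<eta> Z = sfun Z (\<lambda>z. Arrow (\<iota> Z z)) (points C (cop Z))"
  by (simp add: copower_unit_def)

lemma \<epsilon>_simps [simp]:
  assumes "x \<in> Ob C"
  shows "\<epsilon> x \<in> Ar C" "Dom C (\<epsilon> x) = cop (points C x)" "Cod C (\<epsilon> x) = x"
    "p \<in> Ar C \<Longrightarrow> Dom C p = \<one> \<Longrightarrow> Cod C p = x \<Longrightarrow> \<epsilon> x \<cdot> \<iota> (points C x) (Arrow p) = p"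
proof -
  have "\<exists>!h. h \<in> hom C (cop (points C x)) x \<and> (\<forall>p \<in> points C x. h \<cdot> \<iota> (points C x) p = the_Arrow p)"
    by (rule cop_universal) (use assms in \<open>auto elim: points_cases\<close>)
  from theI' [OF this]
  show "\<epsilon> x \<in> Ar C" "Dom C (\<epsilon> x) = cop (points C x)" "Cod C (\<epsilon> x) = x"
    "p \<in> Ar C \<Longrightarrow> Dom C p = \<one> \<Longrightarrow> Cod C p = x \<Longrightarrow> \<epsilon> x \<cdot> \<iota> (points C x) (Arrow p) = p"
    by (auto simp: copower_counit_def hom_iff)
qed

sublocale L: lax_symmetric_monoidal_functor "SET \<kappa>" C L
  by (rule lax_copower_functor)

sublocale R: lax_symmetric_monoidal_functor C "SET \<kappa>" R
  by (rule lax_points_functor)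

text \<open>
  The triangle identities hold because the unit sends \<open>z\<close> to the injection at \<open>z\<close>, while the counit
  sends the injection at a point \<open>p\<close> back to \<open>p\<close>.
\<close>

theorem symmetric_monoidal_adjunction_copower_points:
  "symmetric_monoidal_adjunction (SET \<kappa>) C L R \<eta> \<epsilon>"
proof -
  interpret ID: lax_symmetric_monoidal_functor "SET \<kappa>" "SET \<kappa>" "id_mfunctor (SET \<kappa> :: (('k, 'a) elts, ('k, 'a) sfun) smcat)"
    by (rule SET.lax_id_mfunctor)
  interpret IC: lax_symmetric_monoidal_functor C C "id_mfunctor C"
    by (rule lax_id_mfunctor)
  interpret RL: lax_symmetric_monoidal_functor "SET \<kappa>" "SET \<kappa>" "comp_mfunctor (SET \<kappa>) R L"
    by (rule lax_comp_mfunctor [OF lax_copower_functor lax_points_functor])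
  interpret LR: lax_symmetric_monoidal_functor C C "comp_mfunctor C L R"
    by (rule lax_comp_mfunctor [OF lax_points_functor lax_copower_functor])
  have "monoidal_nat_trans (SET \<kappa>) (SET \<kappa>) (id_mfunctor (SET \<kappa>)) (comp_mfunctor (SET \<kappa>) R L) \<eta>"
    by unfold_locales ((elim SET_hom_cases)?, simp add: hom_iff)+
  moreover have "monoidal_nat_trans C C (comp_mfunctor C L R) (id_mfunctor C) \<epsilon>"
  proof
    fix f x y assume "f \<in> hom C x y"
    then show "\<epsilon> y \<cdot> FA (comp_mfunctor C L R) f = FA (id_mfunctor C) f \<cdot> \<epsilon> x"
      by - (rule cop_points_eqI [of _ _ x], auto simp: hom_iff)
  next
    show "\<epsilon> \<one> \<cdot> M0 (comp_mfunctor C L R) = M0 (id_mfunctor C)"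
      by simp
  next
    fix x y assume "x \<in> Ob C" "y \<in> Ob C"
    then show "\<epsilon> (x \<otimes> y) \<cdot> M2 (comp_mfunctor C L R) x y = M2 (id_mfunctor C) x y \<cdot> (\<epsilon> x \<boxtimes> \<epsilon> y)"
      by - (rule cop_points_TO_cop_points_eqI [of _ _ x y], simp_all)
  qed (simp add: hom_iff)
  moreover have "\<epsilon> (FO L Z) \<cdot> FA L (\<eta> Z) = Idn C (FO L Z)" if "Z \<in> Ob (SET \<kappa>)" for Z
    using that by - (rule cop_eqI [of Z], simp_all)
  moreover have "FA R (\<epsilon> x) \<cdot>\<^bsub>SET \<kappa>\<^esub> \<eta> (FO R x) = Idn (SET \<kappa>) (FO R x)" if "x \<in> Ob C" for x
    using that by simp
  ultimately show ?thesis
    by (intro symmetric_monoidal_adjunction.intro symmetric_monoidal_adjunction_axioms.intro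
      lax_copower_functor lax_points_functor)
qed

end

section \<open>The induced modality on generating points\<close>

lemma lax_symmetric_monoidal_functor_cong:
  assumes "lax_symmetric_monoidal_functor C D F"
    and "FO F = FO G" "FA F = FA G" "M0 F = M0 G" "M2 F = M2 G"
  shows "lax_symmetric_monoidal_functor C D G"
  using assms unfolding lax_symmetric_monoidal_functor_def cat_functor_def cat_functor_axioms_def
    lax_symmetric_monoidal_functor_axioms_def by simp

lemma sprod_cases:
  assumes "p \<in> sprod A B"
  obtains a b where "p = Pr a b" "a \<in> A" "b \<in> B"
  using assms by (auto simp: sprod_def)

context small_unit_copower_category
begin

text \<open>
  The copower functor is strong monoidal.  This is what lets the comonoid structure of sets be
  transported to copowers, and it makes the inverses in the definition of the induced modality
  meaningful.
\<close>

lemma is_iso_M0_L: "is_iso C (\<iota> {Star} Star)"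
proof -
  obtain h where h: "h \<in> Ar C" "Dom C h = cop {Star}" "Cod C h = \<one>" "h \<cdot> \<iota> {Star} Star = Idn C \<one>"
    using cop_universal [of "{Star}" \<one> "\<lambda>z. Idn C \<one>"] by (auto simp: hom_iff)
  moreover have "\<iota> {Star} Star \<cdot> h = Idn C (cop {Star})"
    by (rule cop_eqI [of "{Star}"]) (use h in simp_all)
  ultimately show ?thesis
    unfolding is_iso_def inverse_arrows_def by (intro exI [of _ h]) (simp add: hom_iff)
qed

lemma is_iso_M2_L:
  assumes Z: "|Z| <o \<kappa>" and W: "|W| <o \<kappa>"
  shows "is_iso C (M2 L Z W)"
proof -
  have "\<exists>!h. h \<in> hom C (cop (sprod Z W)) (cop Z \<otimes> cop W) \<and>
      (\<forall>p \<in> sprod Z W. h \<cdot> \<iota> (sprod Z W) p = \<iota> Z (pr1 p) \<star> \<iota> W (pr2 p))"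
    by (rule cop_universal) (use Z W in \<open>auto elim: sprod_cases\<close>)
  then obtain h where "h \<in> hom C (cop (sprod Z W)) (cop Z \<otimes> cop W)"
    and "\<forall>p \<in> sprod Z W. h \<cdot> \<iota> (sprod Z W) p = \<iota> Z (pr1 p) \<star> \<iota> W (pr2 p)"
    by blast
  then have h: "h \<in> Ar C" "Dom C h = cop (sprod Z W)" "Cod C h = cop Z \<otimes> cop W"
    "\<And>z w. z \<in> Z \<Longrightarrow> w \<in> W \<Longrightarrow> h \<cdot> \<iota> (sprod Z W) (Pr z w) = \<iota> Z z \<star> \<iota> W w"
    by (simp_all add: hom_iff)
  have "M2 L Z W \<cdot> h = Idn C (cop (sprod Z W))"
  proof (rule cop_eqI [of "sprod Z W"])
    fix p assume "p \<in> sprod Z W"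
    then show "(M2 L Z W \<cdot> h) \<cdot> \<iota> (sprod Z W) p = Idn C (cop (sprod Z W)) \<cdot> \<iota> (sprod Z W) p"
      by (rule sprod_cases) (use h Z W in simp)
  qed (use h Z W in simp_all)
  moreover have "h \<cdot> M2 L Z W = Idn C (cop Z \<otimes> cop W)"
    by (rule cop_TO_cop_eqI [of Z W]) (use h Z W in simp_all)
  ultimately show ?thesis
    unfolding is_iso_def inverse_arrows_def using h Z W by (intro exI [of _ h]) (simp add: hom_iff)
qed

text \<open>
  From here on the induced modality is used only through its values on the generating points
  \<open>point_inj x p\<close>.
\<close>

definition P :: "('o, 'a) modality" where "P = induced_modality C L R \<eta> \<epsilon>"

definition point_inj :: "'o \<Rightarrow> 'a \<Rightarrow> 'a" where "point_inj x p = \<iota> (points C x) (Arrow p)"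

lemma FO_P_Ob [simp]: "x \<in> Ob C \<Longrightarrow> FO P x \<in> Ob C"
  by (simp add: P_def induced_modality_def)

lemma point_inj_typing [simp]:
  assumes "p \<in> Ar C" "Dom C p = \<one>" "Cod C p = x"
  shows "point_inj x p \<in> Ar C" "Dom C (point_inj x p) = \<one>" "Cod C (point_inj x p) = FO P x"
  using assms Cod_Ob [OF assms(1)] by (simp_all add: point_inj_def P_def induced_modality_def)

lemma P_eqI:
  assumes "f \<in> Ar C" "g \<in> Ar C" "Dom C f = FO P x" "Dom C g = FO P x" "Cod C f = Cod C g" "x \<in> Ob C"
    and "\<And>p. p \<in> Ar C \<Longrightarrow> Dom C p = \<one> \<Longrightarrow> Cod C p = x \<Longrightarrow> f \<cdot> point_inj x p = g \<cdot> point_inj x p"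
  shows "f = g"
  by (rule cop_points_eqI [of f g x])
     (use assms in \<open>simp_all add: point_inj_def P_def induced_modality_def\<close>)

lemma P_TO_P_eqI:
  assumes "f \<in> Ar C" "g \<in> Ar C" "Dom C f = FO P x \<otimes> FO P y" "Dom C g = FO P x \<otimes> FO P y"
    "Cod C f = Cod C g" "x \<in> Ob C" "y \<in> Ob C"
    and "\<And>p q. p \<in> Ar C \<Longrightarrow> Dom C p = \<one> \<Longrightarrow> Cod C p = x \<Longrightarrow> q \<in> Ar C \<Longrightarrow> Dom C q = \<one> \<Longrightarrow> Cod C q = y
      \<Longrightarrow> f \<cdot> (point_inj x p \<star> point_inj y q) = g \<cdot> (point_inj x p \<star> point_inj y q)"
  shows "f = g"
  by (rule cop_points_TO_cop_points_eqI [of f g x y])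
     (use assms in \<open>simp_all add: point_inj_def P_def induced_modality_def\<close>)

lemma FA_P [simp]:
  assumes "f \<in> Ar C" "Dom C f = x"
  shows "FA P f \<in> Ar C" "Dom C (FA P f) = FO P x" "Cod C (FA P f) = FO P (Cod C f)"
    "p \<in> Ar C \<Longrightarrow> Dom C p = \<one> \<Longrightarrow> Cod C p = x \<Longrightarrow> FA P f \<cdot> point_inj x p = point_inj (Cod C f) (f \<cdot> p)"
  using assms by (auto simp add: P_def induced_modality_def point_inj_def)

lemma M0_P [simp]: "M0 P = point_inj \<one> (Idn C \<one>)"
  by (simp add: P_def induced_modality_def point_inj_def)

lemma M2_P [simp]:
  assumes "x \<in> Ob C" "y \<in> Ob C"
  shows "M2 P x y \<in> Ar C" "Dom C (M2 P x y) = FO P x \<otimes> FO P y" "Cod C (M2 P x y) = FO P (x \<otimes> y)"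
    "p \<in> Ar C \<Longrightarrow> Dom C p = \<one> \<Longrightarrow> Cod C p = x \<Longrightarrow> q \<in> Ar C \<Longrightarrow> Dom C q = \<one> \<Longrightarrow> Cod C q = y
      \<Longrightarrow> M2 P x y \<cdot> (point_inj x p \<star> point_inj y q) = point_inj (x \<otimes> y) (p \<star> q)"
  using assms by (simp_all add: P_def induced_modality_def point_inj_def)

lemma Der_P [simp]:
  assumes "x \<in> Ob C"
  shows "Der P x \<in> Ar C" "Dom C (Der P x) = FO P x" "Cod C (Der P x) = x"
    "p \<in> Ar C \<Longrightarrow> Dom C p = \<one> \<Longrightarrow> Cod C p = x \<Longrightarrow> Der P x \<cdot> point_inj x p = p"
  using assms by (simp_all add: P_def induced_modality_def point_inj_def)

lemma Dig_P [simp]: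
  assumes "x \<in> Ob C"
  shows "Dig P x \<in> Ar C" "Dom C (Dig P x) = FO P x" "Cod C (Dig P x) = FO P (FO P x)"
    "p \<in> Ar C \<Longrightarrow> Dom C p = \<one> \<Longrightarrow> Cod C p = x \<Longrightarrow> Dig P x \<cdot> point_inj x p = point_inj (FO P x) (point_inj x p)"
  using assms by (simp_all add: P_def induced_modality_def point_inj_def)

lemma Disc_P [simp]:
  assumes "x \<in> Ob C"
  shows "Disc P x \<in> Ar C" "Dom C (Disc P x) = FO P x" "Cod C (Disc P x) = \<one>"
    "p \<in> Ar C \<Longrightarrow> Dom C p = \<one> \<Longrightarrow> Cod C p = x \<Longrightarrow> Disc P x \<cdot> point_inj x p = Idn C \<one>"
  using assms is_iso_M0_L by (simp_all add: P_def induced_modality_def point_inj_def terminal_map_def)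

lemma Dup_P [simp]:
  assumes "x \<in> Ob C"
  shows "Dup P x \<in> Ar C" "Dom C (Dup P x) = FO P x" "Cod C (Dup P x) = FO P x \<otimes> FO P x"
    "p \<in> Ar C \<Longrightarrow> Dom C p = \<one> \<Longrightarrow> Cod C p = x \<Longrightarrow> Dup P x \<cdot> point_inj x p = point_inj x p \<star> point_inj x p"
  using assms is_iso_M2_L [of "points C x" "points C x"]
  by (simp_all add: P_def induced_modality_def point_inj_def diagonal_def inv_ar_Cmp_eq_iff)

lemma lax_P: "lax_symmetric_monoidal_functor C C P"
  by (rule lax_symmetric_monoidal_functor_cong
      [OF lax_comp_mfunctor [OF lax_points_functor lax_copower_functor]])
     (simp_all add: P_def induced_modality_def)

section \<open>The induced modality is a monoidal coalgebra modality\<close>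

text \<open>
  All axioms are verified on generating points.  For example, both sides of coassociativity of
  digging send \<open>\<iota>\<^sub>p\<close> to the generating point at the generating point at \<open>\<iota>\<^sub>p\<close>.
\<close>

lemma comonad_P: "comonad C P"
proof -
  interpret P: lax_symmetric_monoidal_functor C C P by (rule lax_P)
  interpret Id: lax_symmetric_monoidal_functor C C "id_mfunctor C" by (rule lax_id_mfunctor)
  interpret PP: lax_symmetric_monoidal_functor C C "comp_mfunctor C P P"
    by (rule lax_comp_mfunctor [OF lax_P lax_P])
  show ?thesis
  proof
    fix f x y assume "f \<in> hom C x y"
    then have f: "f \<in> Ar C" "Dom C f = x" "Cod C f = y" "x \<in> Ob C" "y \<in> Ob C"
      by (auto simp: hom_iff)
    show "Der P y \<cdot> FA P f = FA (id_mfunctor C) f \<cdot> Der P x"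
      by (rule P_eqI [of _ _ x]) (use f in simp_all)
    show "Dig P y \<cdot> FA P f = FA (comp_mfunctor C P P) f \<cdot> Dig P x"
      by (rule P_eqI [of _ _ x]) (use f in simp_all)
  next
    fix x assume x: "x \<in> Ob C"
    show "Der P (FO P x) \<cdot> Dig P x = Idn C (FO P x)"
      by (rule P_eqI [of _ _ x]) (use x in simp_all)
    show "FA P (Der P x) \<cdot> Dig P x = Idn C (FO P x)"
      by (rule P_eqI [of _ _ x]) (use x in simp_all)
    show "Dig P (FO P x) \<cdot> Dig P x = FA P (Dig P x) \<cdot> Dig P x"
      by (rule P_eqI [of _ _ x]) (use x in simp_all)
  qed (simp_all add: hom_iff)
qed

lemma monoidal_comonad_P: "monoidal_comonad C P"
proof -
  interpret P: lax_symmetric_monoidal_functor C C P by (rule lax_P)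
  interpret Id: lax_symmetric_monoidal_functor C C "id_mfunctor C" by (rule lax_id_mfunctor)
  interpret PP: lax_symmetric_monoidal_functor C C "comp_mfunctor C P P"
    by (rule lax_comp_mfunctor [OF lax_P lax_P])
  interpret comonad C P by (rule comonad_P)
  show ?thesis
  proof
    fix x y assume x: "x \<in> Ob C" "y \<in> Ob C"
    show "Der P (x \<otimes> y) \<cdot> M2 P x y = M2 (id_mfunctor C) x y \<cdot> (Der P x \<boxtimes> Der P y)"
      by (rule P_TO_P_eqI [of _ _ x y]) (use x in simp_all)
    show "Dig P (x \<otimes> y) \<cdot> M2 P x y = M2 (comp_mfunctor C P P) x y \<cdot> (Dig P x \<boxtimes> Dig P y)"
      by (rule P_TO_P_eqI [of _ _ x y]) (use x in simp_all)
  qed simp_all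
qed

lemma cocommutative_comonoid_P:
  assumes x: "x \<in> Ob C"
  shows "cocommutative_comonoid C (FO P x) (Disc P x) (Dup P x)"
proof
  let ?A = "FO P x"
  show "Asc C ?A ?A ?A \<cdot> (Dup P x \<boxtimes> Idn C ?A) \<cdot> Dup P x = (Idn C ?A \<boxtimes> Dup P x) \<cdot> Dup P x"
    by (rule P_eqI [of _ _ x]) (use x in simp_all)
  show "Lun C ?A \<cdot> (Disc P x \<boxtimes> Idn C ?A) \<cdot> Dup P x = Idn C ?A"
    by (rule P_eqI [of _ _ x]) (use x in simp_all)
  show "Run C ?A \<cdot> (Idn C ?A \<boxtimes> Disc P x) \<cdot> Dup P x = Idn C ?A"
    by (rule P_eqI [of _ _ x]) (use x in simp_all)
  show "Sym C ?A ?A \<cdot> Dup P x = Dup P x"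
    by (rule P_eqI [of _ _ x]) (use x in simp_all)
qed (use x in \<open>simp_all add: hom_iff\<close>)

lemma coalgebra_modality_P: "coalgebra_modality C P"
  proof (intro coalgebra_modality.intro coalgebra_modality_axioms.intro comonad_P
      symmetric_monoidal_category_axioms)
    fix f x y assume "f \<in> hom C x y"
    then have f: "f \<in> Ar C" "Dom C f = x" "Cod C f = y" "x \<in> Ob C" "y \<in> Ob C"
      by (auto simp: hom_iff)
    show "Disc P y \<cdot> FA P f = Disc P x"
      by (rule P_eqI [of _ _ x]) (use f in simp_all)
    show "Dup P y \<cdot> FA P f = (FA P f \<boxtimes> FA P f) \<cdot> Dup P x"
      by (rule P_eqI [of _ _ x]) (use f in simp_all)
  next
    fix x assume x: "x \<in> Ob C"
    show "cocommutative_comonoid C (FO P x) (Disc P x) (Dup P x)"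
      by (rule cocommutative_comonoid_P [OF x])
    have "Disc P (FO P x) \<cdot> Dig P x = Disc P x"
      by (rule P_eqI [of _ _ x]) (use x in simp_all)
    moreover have "Dup P (FO P x) \<cdot> Dig P x = (Dig P x \<boxtimes> Dig P x) \<cdot> Dup P x"
      by (rule P_eqI [of _ _ x]) (use x in simp_all)
    ultimately show "comonoid_hom C (comonoid_of P x) (comonoid_of P (FO P x)) (Dig P x)"
      using x by (simp add: comonoid_of_def hom_iff)
  qed

theorem monoidal_coalgebra_modality_P: "monoidal_coalgebra_modality C P"
proof -
  interpret coalgebra_modality C P by (rule coalgebra_modality_P)
  interpret monoidal_comonad C P by (rule monoidal_comonad_P)
  show ?thesis
  proof
    show "comonoid_hom C (unit_comonoid C) (comonoid_of P \<one>) (M0 P)"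
      by (simp add: unit_comonoid_def comonoid_of_def hom_iff flip: Idn_Unit_point_tensor)
  next
    fix x y assume x: "x \<in> Ob C" "y \<in> Ob C"
    have "Disc P (x \<otimes> y) \<cdot> M2 P x y = Lun C \<one> \<cdot> (Disc P x \<boxtimes> Disc P y)"
      by (rule P_TO_P_eqI [of _ _ x y]) (use x in simp_all)
    moreover have "Dup P (x \<otimes> y) \<cdot> M2 P x y = (M2 P x y \<boxtimes> M2 P x y) \<cdot>
       (middle_swap C (FO P x) (FO P x) (FO P y) (FO P y) \<cdot> (Dup P x \<boxtimes> Dup P y))"
      by (rule P_TO_P_eqI [of _ _ x y]) (use x in simp_all)
    ultimately show "comonoid_hom C (tensor_comonoid C (comonoid_of P x) (comonoid_of P y))
            (comonoid_of P (x \<otimes> y)) (M2 P x y)"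
      using x by (simp add: comonoid_of_def hom_iff)
  next
    fix x assume x: "x \<in> Ob C"
    have "M0 P \<cdot> Disc P x = FA P (Disc P x) \<cdot> Dig P x"
      by (rule P_eqI [of _ _ x]) (use x in simp_all)
    then show "coalgebra_hom C P (FO P x, Dig P x) (\<one>, M0 P) (Disc P x)"
      using x by (simp add: hom_iff)
    have "(M2 P (FO P x) (FO P x) \<cdot> (Dig P x \<boxtimes> Dig P x)) \<cdot> Dup P x = FA P (Dup P x) \<cdot> Dig P x"
      by (rule P_eqI [of _ _ x]) (use x in simp_all)
    then show "coalgebra_hom C P (FO P x, Dig P x)
            (FO P x \<otimes> FO P x, M2 P (FO P x) (FO P x) \<cdot> (Dig P x \<boxtimes> Dig P x)) (Dup P x)"
      using x by (simp add: hom_iff)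
  qed
qed

end

section \<open>Initiality\<close>

locale modality_on_unit_copowers =
  small_unit_copower_category C \<kappa> cop \<iota> + N: monoidal_coalgebra_modality C N
  for C :: "('o, 'a, 'm) smcat_scheme" (structure) and \<kappa> :: "'k rel"
    and cop :: "('k, 'a) elts \<Rightarrow> 'o" and \<iota> :: "('k, 'a) elts \<Rightarrow> ('k, 'a) elt \<Rightarrow> 'a"
    and N :: "('o, 'a) modality"
begin

lemma Disc_Dup_N [simp]:
  assumes "x \<in> Ob C"
  shows "Disc N x \<in> Ar C" "Dom C (Disc N x) = FO N x" "Cod C (Disc N x) = \<one>"
    "Dup N x \<in> Ar C" "Dom C (Dup N x) = FO N x" "Cod C (Dup N x) = FO N x \<otimes> FO N x"
proof -
  interpret cocommutative_comonoid C "FO N x" "Disc N x" "Dup N x"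
    by (rule N.comonoid [OF assms])
  show "Disc N x \<in> Ar C" "Dom C (Disc N x) = FO N x" "Cod C (Disc N x) = \<one>"
    "Dup N x \<in> Ar C" "Dom C (Dup N x) = FO N x" "Cod C (Dup N x) = FO N x \<otimes> FO N x"
    using counit_hom comult_hom by (simp_all add: hom_iff)
qed

lemma Der_Dig_N [simp]:
  assumes "x \<in> Ob C"
  shows "Der N x \<in> Ar C" "Dom C (Der N x) = FO N x" "Cod C (Der N x) = x"
    "Dig N x \<in> Ar C" "Dom C (Dig N x) = FO N x" "Cod C (Dig N x) = FO N (FO N x)"
  using N.Der.component_hom [OF assms] N.Dig.component_hom [OF assms] by (simp_all add: hom_iff)

text \<open>
  In any monoidal coalgebra modality \<open>N\<close>, a point \<open>p\<close> of \<open>x\<close> can be promoted to a point of \<open>N x\<close>.  The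
  lemmas below show that promoted points behave under the operations of \<open>N\<close> as the generating
  points of \<open>P\<close> do: by naturality each reduces to a property of the unit map \<open>M0 N\<close>.
\<close>

definition lift :: "'a \<Rightarrow> 'a" where "lift p = FA N p \<cdot> M0 N"

lemma lift_typing [simp]:
  assumes "p \<in> Ar C" "Dom C p = \<one>"
  shows "lift p \<in> Ar C" "Dom C (lift p) = \<one>" "Cod C (lift p) = FO N (Cod C p)"
  using assms by (simp_all add: lift_def)

lemma lift_Idn: "lift (Idn C \<one>) = M0 N"
  by (simp add: lift_def)

lemma FA_lift [simp]:
  assumes "f \<in> Ar C" "p \<in> Ar C" "Dom C p = \<one>" "Cod C p = Dom C f"
  shows "FA N f \<cdot> lift p = lift (f \<cdot> p)"
  using assms by (simp add: lift_def)

lemma Der_lift: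
  assumes "p \<in> Ar C" "Dom C p = \<one>" "Cod C p = x"
  shows "Der N x \<cdot> lift p = p"
proof -
  have "(Der N x \<cdot> FA N p) \<cdot> M0 N = (p \<cdot> Der N \<one>) \<cdot> M0 N"
    using N.Der.naturality [of p \<one> x] assms by (simp add: hom_iff)
  then show ?thesis
    using N.Der.monoidal_M0 assms by (auto simp add: lift_def)
qed

lemma Dig_lift:
  assumes "p \<in> Ar C" "Dom C p = \<one>" "Cod C p = x"
  shows "Dig N x \<cdot> lift p = lift (lift p)"
proof -
  have "(Dig N x \<cdot> FA N p) \<cdot> M0 N = (FA N (FA N p) \<cdot> Dig N \<one>) \<cdot> M0 N"
    using N.Dig.naturality [of p \<one> x] assms by (simp add: hom_iff)
  then show ?thesis
    using N.Dig.monoidal_M0 assms by (auto simp add: lift_def)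
qed

text \<open>
  By naturality it is enough to multiply two copies of the unit map.  The left unit law
  of \<open>N\<close> shows that the product becomes the unit map after applying \<open>N\<close> to the unitor, and that arrow
  is invertible.
\<close>

lemma M2_lift:
  assumes p: "p \<in> Ar C" "Dom C p = \<one>" "Cod C p = x" and q: "q \<in> Ar C" "Dom C q = \<one>" "Cod C q = y"
  shows "M2 N x y \<cdot> (lift p \<star> lift q) = lift (p \<star> q)"
proof -
  let ?l = "Lun C \<one>" and ?m = "M0 N \<star> M0 N"
  have "FA N ?l \<cdot> (M2 N \<one> \<one> \<cdot> ?m) = (FA N ?l \<cdot> M2 N \<one> \<one> \<cdot> (M0 N \<boxtimes> Idn C (FO N \<one>))) \<cdot> (Idn C \<one> \<star> M0 N)"
    by simp
  also have "\<dots> = Lun C (FO N \<one>) \<cdot> (Idn C \<one> \<star> M0 N)"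
    by (simp only: N.Der.F.M2_Lun Unit_Ob)
  also have "\<dots> = M0 N"
    by simp
  finally have *: "FA N (inv_ar C ?l) \<cdot> (FA N ?l \<cdot> (M2 N \<one> \<one> \<cdot> ?m)) = lift (inv_ar C ?l)"
    by (simp add: lift_def)
  have "FA N (inv_ar C ?l) \<cdot> (FA N ?l \<cdot> (M2 N \<one> \<one> \<cdot> ?m)) = FA N (inv_ar C ?l \<cdot> ?l) \<cdot> (M2 N \<one> \<one> \<cdot> ?m)"
    by (simp del: inv_ar_cancel)
  with * have unit: "M2 N \<one> \<one> \<cdot> ?m = lift (inv_ar C ?l)"
    by simp
  have "M2 N x y \<cdot> (lift p \<star> lift q) = (M2 N x y \<cdot> (FA N p \<boxtimes> FA N q)) \<cdot> ?m"
    using p q by (auto simp: lift_def)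
  also have "\<dots> = (FA N (p \<boxtimes> q) \<cdot> M2 N \<one> \<one>) \<cdot> ?m"
    using N.Der.F.M2_natural [of p \<one> x q \<one> y] p q by (simp add: hom_iff)
  also have "\<dots> = FA N (p \<boxtimes> q) \<cdot> (M2 N \<one> \<one> \<cdot> ?m)"
    using p q by simp
  also have "\<dots> = FA N (p \<boxtimes> q) \<cdot> lift (inv_ar C ?l)"
    by (simp only: unit)
  also have "\<dots> = lift (p \<star> q)"
    using p q by (simp add: point_tensor_def)
  finally show ?thesis .
qed

lemma Disc_lift:
  assumes "p \<in> Ar C" "Dom C p = \<one>" "Cod C p = x"
  shows "Disc N x \<cdot> lift p = Idn C \<one>"
proof -
  have "(Disc N x \<cdot> FA N p) \<cdot> M0 N = Disc N \<one> \<cdot> M0 N"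
    using N.Disc_natural [of p \<one> x] assms by (simp add: hom_iff)
  then show ?thesis
    using N.M0_comonoid_hom assms by (auto simp add: lift_def unit_comonoid_def comonoid_of_def)
qed

lemma Dup_lift:
  assumes "p \<in> Ar C" "Dom C p = \<one>" "Cod C p = x"
  shows "Dup N x \<cdot> lift p = lift p \<star> lift p"
proof -
  have "Dup N x \<cdot> lift p = (Dup N x \<cdot> FA N p) \<cdot> M0 N"
    using assms by (auto simp: lift_def)
  also have "\<dots> = ((FA N p \<boxtimes> FA N p) \<cdot> Dup N \<one>) \<cdot> M0 N"
    using N.Dup_natural [of p \<one> x] assms by (simp add: hom_iff)
  also have "\<dots> = (FA N p \<boxtimes> FA N p) \<cdot> (Dup N \<one> \<cdot> M0 N)"
    using assms by simp
  also have "Dup N \<one> \<cdot> M0 N = M0 N \<star> M0 N"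
    using N.M0_comonoid_hom by (simp add: unit_comonoid_def comonoid_of_def point_tensor_def)
  finally show ?thesis
    using assms by (simp add: lift_def)
qed

text \<open>
  Restricted to the objects of \<open>C\<close>, since arrows of the category of modalities are extensional
  families.
\<close>

definition comparison :: "'o \<Rightarrow> 'a" where
  "comparison = (\<lambda>x \<in> Ob C. THE h. h \<in> hom C (FO P x) (FO N x) \<and>
     (\<forall>p \<in> points C x. h \<cdot> \<iota> (points C x) p = lift (the_Arrow p)))"

lemma comparison_simps [simp]:
  assumes "x \<in> Ob C"
  shows "comparison x \<in> Ar C" "Dom C (comparison x) = FO P x" "Cod C (comparison x) = FO N x"
    "p \<in> Ar C \<Longrightarrow> Dom C p = \<one> \<Longrightarrow> Cod C p = x \<Longrightarrow> comparison x \<cdot> point_inj x p = lift p"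
proof -
  have "\<exists>!h. h \<in> hom C (FO P x) (FO N x) \<and> (\<forall>p \<in> points C x. h \<cdot> \<iota> (points C x) p = lift (the_Arrow p))"
    unfolding P_def induced_modality_def
    by (simp only: comp_mfunctor_simps modality.simps mfunctor.simps cfunctor.simps FO_L points_functor_simps,
        rule cop_universal) (use assms in \<open>auto elim: points_cases\<close>)
  from theI' [OF this] assms
  show "comparison x \<in> Ar C" "Dom C (comparison x) = FO P x" "Cod C (comparison x) = FO N x"
    "p \<in> Ar C \<Longrightarrow> Dom C p = \<one> \<Longrightarrow> Cod C p = x \<Longrightarrow> comparison x \<cdot> point_inj x p = lift p"
    by (simp_all add: comparison_def hom_iff point_inj_def)
qed

text \<open>
  On generating points, every axiom of a morphism turns into the statement that \<open>lift\<close> commutes with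
  one of the operations.
\<close>

lemma modality_morphism_comparison: "modality_morphism C P N comparison"
proof -
  interpret P: monoidal_coalgebra_modality C P by (rule monoidal_coalgebra_modality_P)
  interpret P: lax_symmetric_monoidal_functor C C P by (rule lax_P)
  have "monoidal_nat_trans C C P N comparison"
  proof
    fix f x y assume "f \<in> hom C x y"
    then have f: "f \<in> Ar C" "Dom C f = x" "Cod C f = y" "x \<in> Ob C" "y \<in> Ob C"
      by (auto simp: hom_iff)
    show "comparison y \<cdot> FA P f = FA N f \<cdot> comparison x"
      by (rule P_eqI [of _ _ x]) (use f in simp_all)
  next
    show "comparison \<one> \<cdot> M0 P = M0 N"
      by (simp add: lift_Idn)
  next
    fix x y assume x: "x \<in> Ob C" "y \<in> Ob C"
    show "comparison (x \<otimes> y) \<cdot> M2 P x y = M2 N x y \<cdot> (comparison x \<boxtimes> comparison y)"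
      by (rule P_TO_P_eqI [of _ _ x y]) (use x in \<open>simp_all add: M2_lift\<close>)
  qed (simp add: hom_iff)
  moreover have "Der N x \<cdot> comparison x = Der P x" if "x \<in> Ob C" for x
    by (rule P_eqI [of _ _ x]) (use that in \<open>simp_all add: Der_lift\<close>)
  moreover have "Dig N x \<cdot> comparison x = (comparison (FO N x) \<cdot> FA P (comparison x)) \<cdot> Dig P x"
    if "x \<in> Ob C" for x
    by (rule P_eqI [of _ _ x]) (use that in \<open>simp_all add: Dig_lift\<close>)
  moreover have "Disc N x \<cdot> comparison x = Disc P x" if "x \<in> Ob C" for x
    by (rule P_eqI [of _ _ x]) (use that in \<open>simp_all add: Disc_lift\<close>)
  moreover have "Dup N x \<cdot> comparison x = (comparison x \<boxtimes> comparison x) \<cdot> Dup P x" if "x \<in> Ob C" for x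
    by (rule P_eqI [of _ _ x]) (use that in \<open>simp_all add: Dup_lift\<close>)
  ultimately show ?thesis
    by (intro modality_morphism.intro modality_morphism_axioms.intro
        monoidal_coalgebra_modality_P N.monoidal_coalgebra_modality_axioms)
      (simp_all add: comonoid_of_def hom_iff)
qed

text \<open>
  Every generating point has the form \<open>P p \<cdot> M0 P\<close>, and a morphism of modalities is determined on
  such points by naturality and by compatibility with the unit maps.
\<close>

lemma modality_morphism_unique:
  assumes "modality_morphism C P N \<phi>" "x \<in> Ob C"
  shows "\<phi> x = comparison x"
proof (rule P_eqI [of _ _ x])
  interpret \<phi>: modality_morphism C P N \<phi> by fact
  show \<phi>x: "\<phi> x \<in> Ar C" "Dom C (\<phi> x) = FO P x" "Cod C (\<phi> x) = Cod C (comparison x)"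
    using \<phi>.component_hom [of x] assms(2) by (simp_all add: hom_iff)
  fix p assume p: "p \<in> Ar C" "Dom C p = \<one>" "Cod C p = x"
  have \<phi>1: "\<phi> \<one> \<in> Ar C" "Dom C (\<phi> \<one>) = FO P \<one>" "Cod C (\<phi> \<one>) = FO N \<one>"
    using \<phi>.component_hom [of \<one>] by (simp_all add: hom_iff)
  have "\<phi> x \<cdot> point_inj x p = \<phi> x \<cdot> (FA P p \<cdot> M0 P)"
    using p by simp
  also have "\<dots> = (\<phi> x \<cdot> FA P p) \<cdot> M0 P"
    using p \<phi>x assms by simp
  also have "\<dots> = (FA N p \<cdot> \<phi> \<one>) \<cdot> M0 P"
    using \<phi>.naturality [of p \<one> x] p by (simp add: hom_iff)
  also have "\<dots> = FA N p \<cdot> (\<phi> \<one> \<cdot> M0 P)"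
    using p \<phi>1 by simp
  also have "\<dots> = lift p"
    by (simp only: \<phi>.monoidal_M0 lift_def)
  finally show "\<phi> x \<cdot> point_inj x p = comparison x \<cdot> point_inj x p"
    using p assms by simp
qed (use assms in simp_all)

lemma ex1_modality_morphism: "\<exists>!f. f \<in> hom (modality_category C) P N"
proof (rule ex1I [of _ "(P, comparison, N)"])
  show "(P, comparison, N) \<in> hom (modality_category C) P N"
    using modality_morphism_comparison by (simp add: hom_def modality_category_def comparison_def)
  fix f assume "f \<in> hom (modality_category C) P N"
  then obtain \<phi> where f: "f = (P, \<phi>, N)" "modality_morphism C P N \<phi>" "\<phi> \<in> extensional (Ob C)"
    by (auto simp: hom_def modality_category_def)
  have "\<phi> = comparison"
  proof (rule extensionalityI [OF f(3)])
    show "comparison \<in> extensional (Ob C)"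
      by (simp add: comparison_def)
  qed (rule modality_morphism_unique [OF f(2)])
  with f show "f = (P, comparison, N)"
    by simp
qed

end

theorem (in small_unit_copower_category) initial_object_P:
  "initial_object (modality_category C) P"
  unfolding initial_object_def
proof (intro conjI ballI)
  show "P \<in> Ob (modality_category C)"
    using monoidal_coalgebra_modality_P by (simp add: modality_category_def)
  fix N assume "N \<in> Ob (modality_category C)"
  then interpret N: monoidal_coalgebra_modality C N
    by (simp add: modality_category_def)
  interpret modality_on_unit_copowers C \<kappa> cop \<iota> N ..
  show "\<exists>!f. f \<in> hom (modality_category C) P N"
    by (rule ex1_modality_morphism)
qed

theorem proposition71:
  fixes C :: "('o, 'a) smcat" and \<kappa> :: "'k rel"
    and cop :: "('k, 'a) elts \<Rightarrow> 'o" and \<iota> :: "('k, 'a) elts \<Rightarrow> ('k, 'a) elt \<Rightarrow> 'a"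
  assumes "symmetric_monoidal_category C"
    and "Card_order \<kappa>" and "infinite (Field \<kappa>)"
    and "\<forall>x \<in> Ob C. |hom C \<one>\<^bsub>C\<^esub> x| <o \<kappa>"
    and "unit_copowers C \<kappa> cop \<iota>"
    and "tensor_preserves_unit_copowers C \<kappa> cop \<iota>"
  defines "L \<equiv> copower_functor C cop \<iota>"
    and "R \<equiv> points_functor C"
    and "\<eta> \<equiv> copower_unit C cop \<iota>"
    and "\<epsilon> \<equiv> copower_counit C cop \<iota>"
  shows "symmetric_monoidal_adjunction (SET \<kappa>) C L R \<eta> \<epsilon> \<and>
    initial_object (modality_category C) (induced_modality C L R \<eta> \<epsilon>)"
proof -
  interpret small_unit_copower_category C \<kappa> cop \<iota>
    using assms(1-6)
    by (intro small_unit_copower_category.intro unit_copower_category.intro infinite_cardinal.intro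
        unit_copower_category_axioms.intro small_unit_copower_category_axioms.intro) simp_all
  show ?thesis
    using symmetric_monoidal_adjunction_copower_points initial_object_P
    unfolding P_def L_def R_def \<eta>_def \<epsilon>_def by simp
qed

end
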